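(* Let $n\ge1$. The monodromy matrices $M_j$, $j=1,\dots,m,\infty$, defined by the analytic continuation of $Y_n$ around a closed loop enclosing the singularity $z_j$ (and no other singularity), $$Y_n\big|_{z_j+\delta e^{2\pi i}}=Y_n\big|_{z_j+\delta}\,M_j,$$ are constant with respect to the deformation variable: $\dot M_j=0$.
   Context: Regular semi-classical weight depending on a deformation variable $t$ ($\dot{}=d/dt$): $w(z)=\prod_{j=1}^m(z-z_j(t))^{\rho_j}$ with $m\ge2$ distinct points $z_j=z_j(t)$ depending differentiably on $t$, and $t$-independent exponents $\rho_j\in\mathbb C\setminus\mathbb Z_{\ge0}$. One singular point is fixed at the origin, $z_1=0$ for all $t$. A branch of $w$ analytic in a cut plane is fixed; let $\mathbb T=\{|\zeta|=1\}$ be parametrised by $\zeta=e^{i\theta}$, $\theta\in(-\pi,\pi]$, the cuts being such that on $\mathbb T$ the branch is analytic except possibly at $-1$ and at those $z_j$ lying on $\mathbb T$. For all $t$ assume $w(e^{\pi i})=w(e^{-\pi i})$, $z^jw,z^jw'\in L^1(\mathbb T)$ for all $j\in\mathbb Z$ (so $\mathrm{Re}\,\rho_j>0$ when $z_j\in\mathbb T$), and $\det[w_{j-k}]_{0\le j,k\le n-1}\neq0$ for all $n\ge1$, where $w_k=\int_{\mathbb T}\frac{d\zeta}{2\pi i\zeta}w(\zeta)\zeta^{-k}$. The bi-orthonormal polynomials are $\phi_n(z)=\kappa_nz^n+\dots+\phi_n(0)$ and $\bar\phi_n(z)=\kappa_nz^n+\dots+\bar\phi_n(0)$ with $\kappa_n\neq0$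 (differentiable in $t$), satisfying $\int_{\mathbb T}\frac{d\zeta}{2\pi i\zeta}w(\zeta)\phi_m(\zeta)\bar\phi_n(\bar\zeta)=\delta_{m,n}$, $\bar\zeta=\zeta^{-1}$; the bar on $\bar\phi_n$ is notation, not complex conjugation. $\phi^*_n(z)=z^n\bar\phi_n(1/z)$. Assume $\phi_n(0)\neq0$, $\bar\phi_n(0)\ne0$. For $n\ge1$ and $z\notin\mathbb T$, $\epsilon_n(z)=\int_{\mathbb T}\frac{d\zeta}{2\pi i\zeta}\frac{\zeta+z}{\zeta-z}w(\zeta)\phi_n(\zeta)$ and $\epsilon^*_n(z)=-z^n\int_{\mathbb T}\frac{d\zeta}{2\pi i\zeta}\frac{\zeta+z}{\zeta-z}w(\zeta)\bar\phi_n(\bar\zeta)$. Put $$Y_n(z)=\begin{pmatrix}\phi_n&\epsilon_n/w\\ \phi^*_n&-\epsilon^*_n/w\end{pmatrix}.$$ $Y_n$ satisfies a linear differential system $Y_n'=A_nY_n$ with $A_n(z)=\sum_{j=1}^m\frac{A_{nj}}{z-z_j}$, so it can be continued analytically along paths avoiding $z_1,\dots,z_m$; for $j=\infty$ the loop encloses the singularity at infinity. Here $Y_n|_{z_j+\delta e^{2\pi i}}$ denotes the result of continuing $Y_n$ from $z_j+\delta$ ($\delta\neq 0$ small) once around $z_j$. *)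

theory Defs
  imports "HOL-Complex_Analysis.Complex_Analysis" "Jordan_Normal_Form.Determinant"
begin

no_notation Matrix.vec_index (infixl "$" 100)

section \<open>The weight\<close>

text \<open>
  \<open>v\<close> is an analytic branch on the cut plane \<open>U\<close> of the multivalued function
  \<open>z \<mapsto> (\<Prod>j=1..m. (z - a j) powr \<rho> j)\<close>. The exponentials force the singular points
  \<open>a j\<close> to lie outside \<open>U\<close>, i.e. on the cuts. The logarithms are chosen pointwise and jointly
  because the individual factors need not be single-valued on \<open>U\<close>; since \<open>v\<close> is holomorphic
  on the connected set \<open>U\<close>, it is determined up to one constant factor.
\<close>
definition weight_branch ::
  "nat \<Rightarrow> (nat \<Rightarrow> complex) \<Rightarrow> (nat \<Rightarrow> complex) \<Rightarrow> complex set \<Rightarrow> (complex \<Rightarrow> complex) \<Rightarrow> bool" where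
  "weight_branch m \<rho> a U v \<longleftrightarrow>
     v holomorphic_on U \<and>
     (\<forall>z\<in>U. \<exists>l. (\<forall>j\<in>{1..m}. exp (l j) = z - a j) \<and> v z = exp (\<Sum>j=1..m. \<rho> j * l j))"

definition circle_mean :: "(complex \<Rightarrow> complex) \<Rightarrow> complex" where
  "circle_mean f =
     contour_integral (part_circlepath 0 1 (- pi) pi) (\<lambda>\<zeta>. f \<zeta> / (2 * of_real pi * \<i> * \<zeta>))"

definition circle_L1 :: "(complex \<Rightarrow> complex) \<Rightarrow> bool" where
  "circle_L1 f \<longleftrightarrow> set_integrable lborel {- pi<..pi} (\<lambda>\<theta>. f (cis \<theta>))"

definition moment :: "(complex \<Rightarrow> complex) \<Rightarrow> int \<Rightarrow> complex" where
  "moment v k = circle_mean (\<lambda>\<zeta>. v \<zeta> * \<zeta> powi (- k))"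

definition toeplitz_det :: "(complex \<Rightarrow> complex) \<Rightarrow> nat \<Rightarrow> complex" where
  "toeplitz_det v n = Determinant.det (Matrix.mat n n (\<lambda>(j, k). moment v (int j - int k)))"

section \<open>Associated functions and the matrix $Y_n$\<close>

text \<open>
  In what follows \<open>p\<close> and \<open>q\<close> stand for $\phi_n$ and $\bar\phi_n$; on the unit circle
  $\bar\zeta = \zeta^{-1}$. As $\bar\phi_n$ has degree \<open>n\<close>, the reciprocal polynomial
  $\phi^*_n(z) = z^n\bar\phi_n(1/z)$ is \<open>reflect_poly q\<close>.
\<close>
definition assoc_eps :: "(complex \<Rightarrow> complex) \<Rightarrow> complex poly \<Rightarrow> complex \<Rightarrow> complex" where
  "assoc_eps v p z = circle_mean (\<lambda>\<zeta>. (\<zeta> + z) / (\<zeta> - z) * v \<zeta> * poly p \<zeta>)"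

definition assoc_eps_star ::
  "(complex \<Rightarrow> complex) \<Rightarrow> nat \<Rightarrow> complex poly \<Rightarrow> complex \<Rightarrow> complex" where
  "assoc_eps_star v n q z =
     - (z ^ n) * circle_mean (\<lambda>\<zeta>. (\<zeta> + z) / (\<zeta> - z) * v \<zeta> * poly q (inverse \<zeta>))"

definition Ymat ::
  "(complex \<Rightarrow> complex) \<Rightarrow> nat \<Rightarrow> complex poly \<Rightarrow> complex poly \<Rightarrow> complex \<Rightarrow> complex^2^2" where
  "Ymat v n p q z =
     vector [vector [poly p z, assoc_eps v p z / v z],
             vector [poly (reflect_poly q) z, - assoc_eps_star v n q z / v z]]"

section \<open>Analytic continuation and monodromy\<close>

text \<open>
  The germ of \<open>G\<close> at \<open>\<gamma> 1\<close> is the analytic continuation along \<open>\<gamma>\<close> of the germ of \<open>F\<close> at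
  \<open>\<gamma> 0\<close>: there are function elements \<open>E s\<close>, analytic at \<open>\<gamma> s\<close>, such that neighbouring
  elements agree near the path.
\<close>
definition continues_along ::
  "(real \<Rightarrow> complex) \<Rightarrow> (complex \<Rightarrow> complex^2^2) \<Rightarrow> (complex \<Rightarrow> complex^2^2) \<Rightarrow> bool" where
  "continues_along \<gamma> F G \<longleftrightarrow>
     (\<exists>E :: real \<Rightarrow> complex \<Rightarrow> complex^2^2.
        (\<forall>s\<in>{0..1}. \<forall>i k. (\<lambda>z. E s z $ i $ k) analytic_on {\<gamma> s}) \<and>
        (\<forall>s\<in>{0..1}. \<forall>\<^sub>F s' in at s within {0..1}. \<forall>\<^sub>F z in nhds (\<gamma> s'). E s' z = E s z) \<and>
        (\<forall>\<^sub>F z in nhds (\<gamma> 0). E 0 z = F z) \<and>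
        (\<forall>\<^sub>F z in nhds (\<gamma> 1). E 1 z = G z))"

definition is_monodromy ::
  "(real \<Rightarrow> complex) \<Rightarrow> (complex \<Rightarrow> complex^2^2) \<Rightarrow> complex^2^2 \<Rightarrow> bool" where
  "is_monodromy \<gamma> F M \<longleftrightarrow> continues_along \<gamma> F (\<lambda>z. F z ** M)"

definition monodromy_matrix ::
  "(real \<Rightarrow> complex) \<Rightarrow> (complex \<Rightarrow> complex^2^2) \<Rightarrow> complex^2^2" where
  "monodromy_matrix \<gamma> F = (THE M. is_monodromy \<gamma> F M)"

text \<open>
  The path $z = a + \delta e^{2\pi i s}$, and the corresponding path at infinity, where the local
  coordinate $1/z$ runs through $\delta e^{2\pi i s}$ (so \<open>z\<close> runs clockwise).
\<close>
definition loop_at :: "complex \<Rightarrow> complex \<Rightarrow> real \<Rightarrow> complex" where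
  "loop_at a \<delta> s = a + \<delta> * cis (2 * pi * s)"

definition loop_at_infinity :: "complex \<Rightarrow> real \<Rightarrow> complex" where
  "loop_at_infinity \<delta> s = 1 / (\<delta> * cis (2 * pi * s))"

end

theory Submission
  imports Defs
begin

text \<open>
  The monodromy matrices do not depend on \<open>t\<close> because they are products of transition matrices
  between local fundamental systems, and the entries of these transition matrices are built from
  ratios of branches of the weight. Such a ratio is continuous in \<open>t\<close> and takes its values in the
  countable set of numbers \<open>exp (\<Sum>j. 2 \<pi> \<i> k j * \<rho> j)\<close> with integers \<open>k j\<close>, so it is constant.

  The first column of \<open>Y\<close> is polynomial. The numerators of the second column are integrals over the
  unit circle of the weight times a Laurent polynomial against the kernel \<open>(\<zeta> + z) / (\<zeta> - z)\<close>. By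
  the Plemelj formula (\<open>cauchy_integral_continuation_across_circle\<close>) the function defined outside
  the circle continues to the inside across an arc on which the weight is an analytic branch, and
  it differs there from the function defined inside by twice the density; for both
  rows this jump is the same multiple of the weight times the first column. Hence around every
  point \<open>x\<close> that is not a singular point at time \<open>t0\<close> there is a ball and, for all \<open>t\<close> near \<open>t0\<close>, a
  matrix on this ball with the same first column as \<open>Y\<close> and with second column \<open>H / V\<close>, where \<open>V\<close> is a
  branch of the weight and \<open>H\<close> is the numerator of the second column, taken from outside the circle and
  continued to the inside if the ball meets the circle (\<open>local_frame_exists\<close>). Two
  such frames differ on their overlap by a right factor \<open>[[1, b], [0, d]]\<close> that depends neither on \<open>z\<close>
  nor on \<open>t\<close> (\<open>local_frame_transition\<close>). On an arc through \<open>-1\<close>, where the branch may be cut, the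
  matching of the one-sided limits of the weight provides one constant for both sides.

  Composing transitions along a loop (\<open>continuation_through_frames\<close>) yields one matrix that
  is a monodromy matrix for all \<open>t\<close> near \<open>t0\<close>. It is the only one because the continuation is
  unique (\<open>continues_between_unique\<close>) and \<open>Y\<close> is invertible at the base point: biorthogonality gives
  \<open>det Y = - 2 z ^ n / w z\<close> (\<open>biorthogonal_casoratian\<close>).
\<close>

no_notation fps_nth (infixl "$" 75)

section \<open>Analytic continuation along part of a path\<close>

text \<open>
  The restriction of analytic continuation to the part of the path with parameters in \<open>{a..b}\<close>,
  so that continuations can be composed.
\<close>
definition continues_between ::
  "(real \<Rightarrow> complex) \<Rightarrow> real \<Rightarrow> real \<Rightarrow> (complex \<Rightarrow> complex^2^2) \<Rightarrow> (complex \<Rightarrow> complex^2^2) \<Rightarrow> bool" where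
  "continues_between \<gamma> a b F G \<longleftrightarrow>
     (\<exists>E :: real \<Rightarrow> complex \<Rightarrow> complex^2^2.
        (\<forall>s\<in>{a..b}. \<forall>i k. (\<lambda>z. E s z $ i $ k) analytic_on {\<gamma> s}) \<and>
        (\<forall>s\<in>{a..b}. \<forall>\<^sub>F s' in at s within {a..b}. \<forall>\<^sub>F z in nhds (\<gamma> s'). E s' z = E s z) \<and>
        (\<forall>\<^sub>F z in nhds (\<gamma> a). E a z = F z) \<and>
        (\<forall>\<^sub>F z in nhds (\<gamma> b). E b z = G z))"

lemma continues_along_iff_between:
  "continues_along \<gamma> F G \<longleftrightarrow> continues_between \<gamma> 0 1 F G"
  unfolding continues_along_def continues_between_def ..

lemma continues_between_in_domain:
  assumes "open B" "\<gamma> ` {a..b} \<subseteq> B" "\<And>i k. (\<lambda>z. F z $ i $ k) holomorphic_on B"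
  shows "continues_between \<gamma> a b F F"
  unfolding continues_between_def
proof (intro exI[of _ "\<lambda>_. F"] conjI ballI allI)
  fix s i k assume "s \<in> {a..b}"
  then show "(\<lambda>z. F z $ i $ k) analytic_on {\<gamma> s}"
    using assms analytic_at by blast
qed auto

lemma continues_between_cong:
  assumes "continues_between \<gamma> a b F G"
    and "\<forall>\<^sub>F z in nhds (\<gamma> a). F z = F' z" "\<forall>\<^sub>F z in nhds (\<gamma> b). G z = G' z"
  shows "continues_between \<gamma> a b F' G'"
proof -
  obtain E where E: "\<forall>s\<in>{a..b}. \<forall>i k. (\<lambda>z. E s z $ i $ k) analytic_on {\<gamma> s}"
      "\<forall>s\<in>{a..b}. \<forall>\<^sub>F s' in at s within {a..b}. \<forall>\<^sub>F z in nhds (\<gamma> s'). E s' z = E s z"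
      "\<forall>\<^sub>F z in nhds (\<gamma> a). E a z = F z" "\<forall>\<^sub>F z in nhds (\<gamma> b). E b z = G z"
    using assms(1) unfolding continues_between_def by blast
  have "\<forall>\<^sub>F z in nhds (\<gamma> a). E a z = F' z" "\<forall>\<^sub>F z in nhds (\<gamma> b). E b z = G' z"
    using eventually_elim2[OF E(3) assms(2), of "\<lambda>z. E a z = F' z"]
      eventually_elim2[OF E(4) assms(3), of "\<lambda>z. E b z = G' z"] by simp_all
  with E(1,2) show ?thesis unfolding continues_between_def by blast
qed

lemma continues_between_mult_right:
  assumes "continues_between \<gamma> a b F G"
  shows "continues_between \<gamma> a b (\<lambda>z. F z ** N) (\<lambda>z. G z ** N)"
proof -
  obtain E where E: "\<forall>s\<in>{a..b}. \<forall>i k. (\<lambda>z. E s z $ i $ k) analytic_on {\<gamma> s}"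
      "\<forall>s\<in>{a..b}. \<forall>\<^sub>F s' in at s within {a..b}. \<forall>\<^sub>F z in nhds (\<gamma> s'). E s' z = E s z"
      "\<forall>\<^sub>F z in nhds (\<gamma> a). E a z = F z" "\<forall>\<^sub>F z in nhds (\<gamma> b). E b z = G z"
    using assms(1) unfolding continues_between_def by blast
  show ?thesis unfolding continues_between_def
  proof (intro exI[of _ "\<lambda>s z. E s z ** N"] conjI ballI allI)
    fix s i k assume s: "s \<in> {a..b}"
    then show "(\<lambda>z. (E s z ** N) $ i $ k) analytic_on {\<gamma> s}"
      using E(1) by (simp add: matrix_matrix_mult_def) (intro analytic_intros; simp)
    show "\<forall>\<^sub>F s' in at s within {a..b}. \<forall>\<^sub>F z in nhds (\<gamma> s'). E s' z ** N = E s z ** N"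
      using E(2)[rule_format, OF s] by (rule eventually_mono) (auto elim: eventually_mono)
  qed (use E(3,4) in \<open>auto elim: eventually_mono\<close>)
qed

text \<open>
  The two families of function elements are glued at \<open>b\<close>. Near \<open>\<gamma> b\<close> both represent the germ of \<open>G\<close>,
  and by continuity of the path this persists at \<open>\<gamma> s'\<close> for \<open>s'\<close> near \<open>b\<close>.
\<close>
lemma continues_between_trans:
  assumes "continues_between \<gamma> a b F G" "continues_between \<gamma> b c G H"
    and "a \<le> b" "b \<le> c" and cont: "continuous_on {a..c} \<gamma>"
  shows "continues_between \<gamma> a c F H"
proof -
  obtain E where E: "\<forall>s\<in>{a..b}. \<forall>i k. (\<lambda>z. E s z $ i $ k) analytic_on {\<gamma> s}"
      "\<forall>s\<in>{a..b}. \<forall>\<^sub>F s' in at s within {a..b}. \<forall>\<^sub>F z in nhds (\<gamma> s'). E s' z = E s z"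
      "\<forall>\<^sub>F z in nhds (\<gamma> a). E a z = F z" "\<forall>\<^sub>F z in nhds (\<gamma> b). E b z = G z"
    using assms(1) unfolding continues_between_def by blast
  obtain E' where E': "\<forall>s\<in>{b..c}. \<forall>i k. (\<lambda>z. E' s z $ i $ k) analytic_on {\<gamma> s}"
      "\<forall>s\<in>{b..c}. \<forall>\<^sub>F s' in at s within {b..c}. \<forall>\<^sub>F z in nhds (\<gamma> s'). E' s' z = E' s z"
      "\<forall>\<^sub>F z in nhds (\<gamma> b). E' b z = G z" "\<forall>\<^sub>F z in nhds (\<gamma> c). E' c z = H z"
    using assms(2) unfolding continues_between_def by blast
  define K where "K s = (if s \<le> b then E s else E' s)" for s
  have glue: "\<forall>\<^sub>F z in nhds (\<gamma> b). E b z = E' b z"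
    using eventually_elim2[OF E(4) E'(3), of "\<lambda>z. E b z = E' b z"] by simp
  then obtain S where S: "open S" "\<gamma> b \<in> S" "\<And>z. z \<in> S \<Longrightarrow> E b z = E' b z"
    unfolding eventually_nhds by blast
  have K_right: "\<forall>\<^sub>F z in nhds (\<gamma> s). K s z = E' s z" if "s \<ge> b" for s
    using glue that by (cases "s = b") (auto simp: K_def)
  \<comment> \<open>At \<open>s = b\<close> the left and right neighbourhoods are governed by different families.\<close>
  have loc_left: "\<forall>\<^sub>F s' in at s within {a..b}. \<forall>\<^sub>F z in nhds (\<gamma> s'). K s' z = K s z"
    if s: "s \<in> {a..c}" for s
  proof (cases "s \<le> b")
    case True
    then have "\<forall>\<^sub>F s' in at s within {a..b}. \<forall>\<^sub>F z in nhds (\<gamma> s'). E s' z = E s z"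
      using E(2) s by auto
    moreover have "\<forall>\<^sub>F s' in at s within {a..b}. s' \<in> {a..b}"
      by (auto simp: eventually_at_filter)
    ultimately show ?thesis
      by eventually_elim (use True in \<open>auto simp: K_def\<close>)
  next
    case False
    then have "\<forall>\<^sub>F s' in at s within {a..b}. False"
      using eventually_at_topological[of "\<lambda>_. False" s "{a..b}"] open_greaterThan[of b]
      by (metis atLeastAtMost_iff greaterThan_iff linorder_not_le)
    then show ?thesis by (rule eventually_mono) simp
  qed
  have loc_right: "\<forall>\<^sub>F s' in at s within {b..c}. \<forall>\<^sub>F z in nhds (\<gamma> s'). K s' z = K s z"
    if s: "s \<in> {a..c}" for s
  proof (cases "b \<le> s")
    case True
    have "s \<in> {b..c}" using True s by auto
    then have ev1: "\<forall>\<^sub>F s' in at s within {b..c}. \<forall>\<^sub>F z in nhds (\<gamma> s'). E' s' z = E' s z"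
      using E'(2) by auto
    have ev2: "\<forall>\<^sub>F s' in at s within {b..c}. s' \<in> {b..c}"
      by (auto simp: eventually_at_filter)
    have "continuous_on {b..c} \<gamma>" using cont assms(3) by (auto intro: continuous_on_subset)
    then have lim: "(\<gamma> \<longlongrightarrow> \<gamma> s) (at s within {b..c})"
      using \<open>s \<in> {b..c}\<close> by (auto simp: continuous_on_def)
    obtain S' where S': "open S'" "\<gamma> s \<in> S'" "\<And>z. z \<in> S' \<Longrightarrow> K s z = E' s z"
      using K_right[OF True] unfolding eventually_nhds by blast
    have "\<forall>\<^sub>F s' in at s within {b..c}. \<gamma> s' \<in> S'"
      using lim S'(1,2) by (rule topological_tendstoD)
    then have ev3: "\<forall>\<^sub>F s' in at s within {b..c}. \<forall>\<^sub>F z in nhds (\<gamma> s'). K s z = E' s z"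
      by eventually_elim (use S' in \<open>auto simp: eventually_nhds\<close>)
    show ?thesis using ev1 ev2 ev3
    proof eventually_elim
      case (elim s')
      have "b \<le> s'" using elim(2) by simp
      from elim(1) elim(3) K_right[OF this] show ?case by eventually_elim simp
    qed
  next
    case False
    then have "\<forall>\<^sub>F s' in at s within {b..c}. False"
      using eventually_at_topological[of "\<lambda>_. False" s "{b..c}"] open_lessThan[of b]
      by (metis atLeastAtMost_iff lessThan_iff linorder_not_le)
    then show ?thesis by (rule eventually_mono) simp
  qed
  show ?thesis unfolding continues_between_def
  proof (intro exI[of _ K] conjI ballI allI)
    fix s i k assume s: "s \<in> {a..c}"
    show "(\<lambda>z. K s z $ i $ k) analytic_on {\<gamma> s}"
      using E(1) E'(1) s by (cases "s \<le> b") (auto simp: K_def)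
    have "{a..c} = {a..b} \<union> {b..c}" using assms(3,4) by auto
    then show "\<forall>\<^sub>F s' in at s within {a..c}. \<forall>\<^sub>F z in nhds (\<gamma> s'). K s' z = K s z"
      using loc_left[OF s] loc_right[OF s] by (simp add: at_within_union eventually_sup)
  next
    show "\<forall>\<^sub>F z in nhds (\<gamma> a). K a z = F z" using E(3) assms(3) by (simp add: K_def)
    show "\<forall>\<^sub>F z in nhds (\<gamma> c). K c z = H z"
      using eventually_elim2[OF K_right[OF assms(4)] E'(4), of "\<lambda>z. K c z = H z"] by simp
  qed
qed

lemma holomorphic_germ_eq_on_ball:
  fixes f g :: "complex \<Rightarrow> complex"
  assumes "f holomorphic_on ball c r" "g holomorphic_on ball c r" "x \<in> ball c r"
    and "\<forall>\<^sub>F z in nhds x. f z = g z" and "z \<in> ball c r"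
  shows "f z = g z"
proof -
  obtain S where S: "open S" "x \<in> S" "\<And>z. z \<in> S \<Longrightarrow> f z = g z"
    using assms(4) unfolding eventually_nhds by blast
  show ?thesis
    by (rule analytic_continuation_open[of "S \<inter> ball c r" "ball c r" f g])
      (use S assms in \<open>auto simp: convex_connected\<close>)
qed

text \<open>
  The set of parameters at which the two families of function elements have the same germ is
  open and closed: near a given \<open>s\<close> all elements of each family are restrictions of one
  function on a ball around \<open>\<gamma> s\<close>, where the identity theorem applies.
\<close>
lemma continues_between_unique:
  assumes "continues_between \<gamma> a b F G" "continues_between \<gamma> a b F G'"
    and "a \<le> b" and cont: "continuous_on {a..b} \<gamma>"
  shows "\<forall>\<^sub>F z in nhds (\<gamma> b). G z = G' z"
proof -
  obtain E where E: "\<forall>s\<in>{a..b}. \<forall>i k. (\<lambda>z. E s z $ i $ k) analytic_on {\<gamma> s}"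
      "\<forall>s\<in>{a..b}. \<forall>\<^sub>F s' in at s within {a..b}. \<forall>\<^sub>F z in nhds (\<gamma> s'). E s' z = E s z"
      "\<forall>\<^sub>F z in nhds (\<gamma> a). E a z = F z" "\<forall>\<^sub>F z in nhds (\<gamma> b). E b z = G z"
    using assms(1) unfolding continues_between_def by blast
  obtain E' where E': "\<forall>s\<in>{a..b}. \<forall>i k. (\<lambda>z. E' s z $ i $ k) analytic_on {\<gamma> s}"
      "\<forall>s\<in>{a..b}. \<forall>\<^sub>F s' in at s within {a..b}. \<forall>\<^sub>F z in nhds (\<gamma> s'). E' s' z = E' s z"
      "\<forall>\<^sub>F z in nhds (\<gamma> a). E' a z = F z" "\<forall>\<^sub>F z in nhds (\<gamma> b). E' b z = G' z"
    using assms(2) unfolding continues_between_def by blast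
  define P where "P s \<longleftrightarrow> (\<forall>\<^sub>F z in nhds (\<gamma> s). E s z = E' s z)" for s
  have "P b"
  proof (rule connected_induction_simple[of "{a..b}" a b P])
    show "P a" unfolding P_def using eventually_elim2[OF E(3) E'(3)] by simp
    fix s assume s: "s \<in> {a..b}"
    have "\<forall>i k. \<exists>r>0. (\<lambda>z. E s z $ i $ k) holomorphic_on ball (\<gamma> s) r"
      "\<forall>i k. \<exists>r>0. (\<lambda>z. E' s z $ i $ k) holomorphic_on ball (\<gamma> s) r"
      using E(1) E'(1) s unfolding analytic_on_def by auto
    then obtain r r' where r: "\<And>i k. r i k > 0" "\<And>i k. (\<lambda>z. E s z $ i $ k) holomorphic_on ball (\<gamma> s) (r i k)"
      and r': "\<And>i k. r' i k > 0" "\<And>i k. (\<lambda>z. E' s z $ i $ k) holomorphic_on ball (\<gamma> s) (r' i k)"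
      by metis
    define R where "R = Min (range (\<lambda>(i,k). min (r i k) (r' i k)))"
    have R: "R > 0" "\<And>i k. R \<le> r i k" "\<And>i k. R \<le> r' i k"
    proof -
      show "R > 0" unfolding R_def by (subst Min_gr_iff) (auto simp: r(1) r'(1))
      have "R \<le> (\<lambda>(i,k). min (r i k) (r' i k)) (i,k)" for i k
        unfolding R_def by (rule Min_le) auto
      then show "R \<le> r i k" "R \<le> r' i k" for i k by (auto simp: case_prod_beta)
    qed
    have hol: "(\<lambda>z. E s z $ i $ k) holomorphic_on ball (\<gamma> s) R"
      "(\<lambda>z. E' s z $ i $ k) holomorphic_on ball (\<gamma> s) R" for i k
      using r(2)[of i k] r'(2)[of i k] R by (meson holomorphic_on_subset subset_ball)+
    have lim: "(\<gamma> \<longlongrightarrow> \<gamma> s) (at s within {a..b})"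
      using cont s by (auto simp: continuous_on_def)
    then have "\<forall>\<^sub>F s' in at s within {a..b}. \<gamma> s' \<in> ball (\<gamma> s) R"
      using R(1) by (intro topological_tendstoD) auto
    then have "\<forall>\<^sub>F s' in at s within {a..b}. \<gamma> s' \<in> ball (\<gamma> s) R \<and>
        (\<forall>\<^sub>F z in nhds (\<gamma> s'). E s' z = E s z) \<and> (\<forall>\<^sub>F z in nhds (\<gamma> s'). E' s' z = E' s z)"
      using E(2)[rule_format, OF s] E'(2)[rule_format, OF s] by eventually_elim auto
    then obtain T where T: "open T" "s \<in> T" and
      Tprop: "\<And>s'. s' \<in> T \<Longrightarrow> s' \<noteq> s \<Longrightarrow> s' \<in> {a..b} \<Longrightarrow> \<gamma> s' \<in> ball (\<gamma> s) R \<and>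
        (\<forall>\<^sub>F z in nhds (\<gamma> s'). E s' z = E s z) \<and> (\<forall>\<^sub>F z in nhds (\<gamma> s'). E' s' z = E' s z)"
      unfolding eventually_at_topological by blast
    have Tprop': "\<gamma> s' \<in> ball (\<gamma> s) R \<and>
        (\<forall>\<^sub>F z in nhds (\<gamma> s'). E s' z = E s z) \<and> (\<forall>\<^sub>F z in nhds (\<gamma> s'). E' s' z = E' s z)"
      if "s' \<in> {a..b} \<inter> T" for s' using Tprop[of s'] that R(1) by (cases "s' = s") auto
    have "P y" if x: "x \<in> {a..b} \<inter> T" and y: "y \<in> {a..b} \<inter> T" and "P x" for x y
    proof -
      have "\<forall>\<^sub>F z in nhds (\<gamma> x). E s z = E' s z"
        using Tprop'[OF x, THEN conjunct2, THEN conjunct1] Tprop'[OF x, THEN conjunct2, THEN conjunct2]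
          \<open>P x\<close>[unfolded P_def] by eventually_elim simp
      then have "\<forall>\<^sub>F z in nhds (\<gamma> x). E s z $ i $ k = E' s z $ i $ k" for i k
        by eventually_elim simp
      then have "E s z $ i $ k = E' s z $ i $ k" if "z \<in> ball (\<gamma> s) R" for z i k
        using holomorphic_germ_eq_on_ball[OF hol] Tprop'[OF x] that by blast
      then have eq: "E s z = E' s z" if "z \<in> ball (\<gamma> s) R" for z
        using that by (simp add: Finite_Cartesian_Product.vec_eq_iff)
      have "\<forall>\<^sub>F z in nhds (\<gamma> y). z \<in> ball (\<gamma> s) R"
        using Tprop'[OF y] by (intro eventually_nhds_in_open) auto
      then show "P y" unfolding P_def
        using Tprop'[OF y, THEN conjunct2, THEN conjunct1] Tprop'[OF y, THEN conjunct2, THEN conjunct2]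
        by eventually_elim (simp add: eq)
    qed
    moreover have "openin (top_of_set {a..b}) ({a..b} \<inter> T)"
      using T(1) by (rule openin_open_Int)
    ultimately show "\<exists>U. openin (top_of_set {a..b}) U \<and> s \<in> U \<and> (\<forall>x\<in>U. \<forall>y\<in>U. P x \<longrightarrow> P y)"
      using T(2) s by (intro exI[of _ "{a..b} \<inter> T"]) blast
  qed (use assms(3) in auto)
  then show ?thesis unfolding P_def using E(4) E'(4) by eventually_elim simp
qed

section \<open>Continuation through frames with constant transition matrices\<close>

text \<open>
  The mechanism behind the constancy of monodromy. A frame is an open set with a
  \<open>t\<close>-dependent matrix function on it; the transition matrix between two frames is the same for all
  \<open>t\<close> near \<open>t0\<close>, and so is every product of transition matrices. A bisection argument on the parameter
  interval replaces the choice of a finite chain of frames. The path moves with \<open>t\<close> by the translation \<open>d t\<close>.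
\<close>
lemma continuation_through_frames:
  fixes \<gamma> d :: "real \<Rightarrow> complex"
    and frames :: "(complex set \<times> (real \<Rightarrow> complex \<Rightarrow> complex^2^2)) set"
  assumes cont: "continuous_on UNIV \<gamma>" and d: "(d \<longlongrightarrow> 0) (nhds t0)"
    and cover: "\<And>s. \<exists>B F. (B, F) \<in> frames \<and> \<gamma> s \<in> B"
    and opn: "\<And>B F. (B, F) \<in> frames \<Longrightarrow> open B"
    and hol: "\<And>B F. (B, F) \<in> frames \<Longrightarrow>
        \<forall>\<^sub>F t in nhds t0. \<forall>i k. (\<lambda>z. F t z $ i $ k) holomorphic_on B"
    and trans: "\<And>B F B' F'. (B, F) \<in> frames \<Longrightarrow> (B', F') \<in> frames \<Longrightarrow>
        \<exists>N. \<forall>\<^sub>F t in nhds t0. \<forall>z\<in>B \<inter> B'. F t z = F' t z ** N"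
    and "a \<le> b" "(B, F) \<in> frames" "\<gamma> a \<in> B" "(B', F') \<in> frames" "\<gamma> b \<in> B'"
  shows "\<exists>N. \<forall>\<^sub>F t in nhds t0. continues_between (\<lambda>s. \<gamma> s + d t) a b (F t) (\<lambda>z. F' t z ** N)"
proof -
  define P where "P a b \<longleftrightarrow> (\<forall>B F B' F'. (B, F) \<in> frames \<longrightarrow> \<gamma> a \<in> B \<longrightarrow> (B', F') \<in> frames \<longrightarrow> \<gamma> b \<in> B' \<longrightarrow>
      (\<exists>N. \<forall>\<^sub>F t in nhds t0. continues_between (\<lambda>s. \<gamma> s + d t) a b (F t) (\<lambda>z. F' t z ** N)))" for a b
  have cont_shift: "continuous_on S (\<lambda>s. \<gamma> s + d t)" for S t
    using cont by (intro continuous_intros) (auto intro: continuous_on_subset)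
  have shift_in: "\<forall>\<^sub>F t in nhds t0. \<gamma> s + d t \<in> S" if "open S" "\<gamma> s \<in> S" for s S
  proof -
    have "((\<lambda>t. \<gamma> s + d t) \<longlongrightarrow> \<gamma> s + 0) (nhds t0)" by (intro tendsto_intros d)
    then show ?thesis using that by (auto dest: topological_tendstoD)
  qed
  have "P a b" using \<open>a \<le> b\<close>
  proof (induction a b rule: Bolzano)
    case (trans a b c)
    show ?case unfolding P_def
    proof (intro allI impI)
      fix B F B' F' assume fr: "(B, F) \<in> frames" "\<gamma> a \<in> B" "(B', F') \<in> frames" "\<gamma> c \<in> B'"
      obtain B0 F0 where fr0: "(B0, F0) \<in> frames" "\<gamma> b \<in> B0" using cover by blast
      obtain N1 where N1: "\<forall>\<^sub>F t in nhds t0. continues_between (\<lambda>s. \<gamma> s + d t) a b (F t) (\<lambda>z. F0 t z ** N1)"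
        using trans(1) fr fr0 unfolding P_def by blast
      obtain N2 where N2: "\<forall>\<^sub>F t in nhds t0. continues_between (\<lambda>s. \<gamma> s + d t) b c (F0 t) (\<lambda>z. F' t z ** N2)"
        using trans(2) fr fr0 unfolding P_def by blast
      have "\<forall>\<^sub>F t in nhds t0. continues_between (\<lambda>s. \<gamma> s + d t) a c (F t) (\<lambda>z. F' t z ** (N2 ** N1))"
        using N1 N2
      proof eventually_elim
        case (elim t)
        have "continues_between (\<lambda>s. \<gamma> s + d t) b c (\<lambda>z. F0 t z ** N1) (\<lambda>z. F' t z ** (N2 ** N1))"
          using continues_between_mult_right[OF elim(2), of N1] by (simp add: matrix_mul_assoc)
        then show ?case
          using continues_between_trans[OF elim(1)] trans(3,4) cont_shift by blast
      qed
      then show "\<exists>N. \<forall>\<^sub>F t in nhds t0. continues_between (\<lambda>s. \<gamma> s + d t) a c (F t) (\<lambda>z. F' t z ** N)" by blast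
    qed
  next
    case (local s)
    obtain B0 F0 where fr0: "(B0, F0) \<in> frames" "\<gamma> s \<in> B0" using cover by blast
    obtain e where e: "e > 0" "ball (\<gamma> s) e \<subseteq> B0" using opn[OF fr0(1)] fr0(2) openE by blast
    have "isCont \<gamma> s" using cont by (simp add: continuous_on_eq_continuous_at)
    then obtain \<eta> where \<eta>: "\<eta> > 0" "\<And>s'. dist s' s < \<eta> \<Longrightarrow> dist (\<gamma> s') (\<gamma> s) < e / 2"
      using e(1) unfolding continuous_at_eps_delta by (metis half_gt_zero)
    have small: "\<forall>\<^sub>F t in nhds t0. norm (d t) < e / 2"
      using tendstoD[OF d, of "e/2"] e(1) by simp
    have "P a b" if ab: "a \<le> s \<and> s \<le> b \<and> b - a < \<eta>" for a b
      unfolding P_def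
    proof (intro allI impI)
      have near: "dist (\<gamma> s') (\<gamma> s) < e / 2" if "s' \<in> {a..b}" for s'
        using \<eta>(2)[of s'] ab that by (auto simp: dist_real_def)
      fix B F B' F' assume fr: "(B, F) \<in> frames" "\<gamma> a \<in> B" "(B', F') \<in> frames" "\<gamma> b \<in> B'"
      obtain N1 where N1: "\<forall>\<^sub>F t in nhds t0. \<forall>z\<in>B \<inter> B0. F t z = F0 t z ** N1"
        using assms(6)[OF fr(1) fr0(1)] by blast
      obtain N2 where N2: "\<forall>\<^sub>F t in nhds t0. \<forall>z\<in>B0 \<inter> B'. F0 t z = F' t z ** N2"
        using assms(6)[OF fr0(1) fr(3)] by blast
      have "\<gamma> a \<in> ball (\<gamma> s) e" "\<gamma> b \<in> ball (\<gamma> s) e"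
        using near[of a] near[of b] ab e(1) by (auto simp: dist_commute)
      then have ab_in: "\<gamma> a \<in> B \<inter> B0" "\<gamma> b \<in> B0 \<inter> B'" using fr e(2) by auto
      have ev_a: "\<forall>\<^sub>F t in nhds t0. \<gamma> a + d t \<in> B \<inter> B0"
        and ev_b: "\<forall>\<^sub>F t in nhds t0. \<gamma> b + d t \<in> B0 \<inter> B'"
        by (intro shift_in ab_in open_Int opn[OF fr(1)] opn[OF fr(3)] opn[OF fr0(1)])+
      have "\<forall>\<^sub>F t in nhds t0. continues_between (\<lambda>s. \<gamma> s + d t) a b (F t) (\<lambda>z. F' t z ** (N2 ** N1))"
        using N1 N2 ev_a ev_b small hol[OF fr0(1)]
      proof eventually_elim
        case (elim t)
        have "\<gamma> s' + d t \<in> ball (\<gamma> s) e" if "s' \<in> {a..b}" for s'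
        proof -
          have "norm ((\<gamma> s' - \<gamma> s) + d t) < e"
            using near[OF that] elim(5) norm_triangle_ineq[of "\<gamma> s' - \<gamma> s" "d t"]
            by (simp add: dist_norm)
          moreover have "(\<gamma> s' - \<gamma> s) + d t = (\<gamma> s' + d t) - \<gamma> s" by simp
          ultimately show ?thesis by (simp only: mem_ball dist_norm norm_minus_commute)
        qed
        then have "(\<lambda>s. \<gamma> s + d t) ` {a..b} \<subseteq> B0" using e(2) by blast
        then have "continues_between (\<lambda>s. \<gamma> s + d t) a b (F0 t) (F0 t)"
          using continues_between_in_domain opn[OF fr0(1)] elim(6) by blast
        then have 1: "continues_between (\<lambda>s. \<gamma> s + d t) a b (\<lambda>z. F0 t z ** N1) (\<lambda>z. F0 t z ** N1)"
          by (rule continues_between_mult_right)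
        have "\<forall>\<^sub>F z in nhds (\<gamma> a + d t). z \<in> B \<inter> B0" "\<forall>\<^sub>F z in nhds (\<gamma> b + d t). z \<in> B0 \<inter> B'"
          by (intro eventually_nhds_in_open open_Int opn[OF fr(1)] opn[OF fr(3)] opn[OF fr0(1)] elim)+
        then have 2: "\<forall>\<^sub>F z in nhds (\<gamma> a + d t). F0 t z ** N1 = F t z"
          and 3: "\<forall>\<^sub>F z in nhds (\<gamma> b + d t). F0 t z ** N1 = F' t z ** (N2 ** N1)"
          using elim(1,2) by (auto elim!: eventually_mono simp: matrix_mul_assoc)
        show ?case by (rule continues_between_cong[OF 1 2 3])
      qed
      then show "\<exists>N. \<forall>\<^sub>F t in nhds t0. continues_between (\<lambda>s. \<gamma> s + d t) a b (F t) (\<lambda>z. F' t z ** N)" by blast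
    qed
    then show ?case using \<eta>(1) by blast
  qed
  then show ?thesis using assms unfolding P_def by blast
qed

section \<open>Branches of the weight\<close>

text \<open>
  One of the values at \<open>x\<close> of the multivalued weight.
\<close>
definition weight_value ::
  "nat \<Rightarrow> (nat \<Rightarrow> complex) \<Rightarrow> (nat \<Rightarrow> complex) \<Rightarrow> complex \<Rightarrow> complex \<Rightarrow> bool" where
  "weight_value m \<rho> a x v \<longleftrightarrow>
     (\<exists>l. (\<forall>j\<in>{1..m}. exp (l j) = x - a j) \<and> v = exp (\<Sum>j=1..m. \<rho> j * l j))"

lemma weight_value_nonzero: "weight_value m \<rho> a x v \<Longrightarrow> v \<noteq> 0"
  by (auto simp: weight_value_def)

lemma weight_value_not_singular: "weight_value m \<rho> a x v \<Longrightarrow> j \<in> {1..m} \<Longrightarrow> x \<noteq> a j"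
  unfolding weight_value_def by (metis exp_not_eq_zero right_minus_eq)

text \<open>
  The quotients of two values of the multivalued weight at one point. Extensional functions on
  \<open>{1..m}\<close> serve as index set because there are only countably many of them.
\<close>
definition weight_multipliers :: "nat \<Rightarrow> (nat \<Rightarrow> complex) \<Rightarrow> complex set" where
  "weight_multipliers m \<rho> =
     (\<lambda>k. exp (\<Sum>j=1..m. \<rho> j * (of_int (2 * k j) * of_real pi * \<i>))) ` ({1..m} \<rightarrow>\<^sub>E (UNIV :: int set))"

lemma countable_weight_multipliers: "countable (weight_multipliers m \<rho>)"
  unfolding weight_multipliers_def by (intro countable_image countable_PiE) auto

lemma weight_value_ratio:
  assumes "weight_value m \<rho> a x v" "weight_value m \<rho> a x v'"
  shows "v / v' \<in> weight_multipliers m \<rho>"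
proof -
  obtain l l' where l: "\<forall>j\<in>{1..m}. exp (l j) = x - a j" "v = exp (\<Sum>j=1..m. \<rho> j * l j)"
    and l': "\<forall>j\<in>{1..m}. exp (l' j) = x - a j" "v' = exp (\<Sum>j=1..m. \<rho> j * l' j)"
    using assms unfolding weight_value_def by blast
  have "\<exists>k::int. l j = l' j + of_int (2 * k) * of_real pi * \<i>" if "j \<in> {1..m}" for j
  proof -
    have "exp (l j) = exp (l' j)" using l(1) l'(1) that by simp
    then show ?thesis unfolding exp_eq by simp
  qed
  then obtain k :: "nat \<Rightarrow> int"
    where k: "\<And>j. j \<in> {1..m} \<Longrightarrow> l j = l' j + of_int (2 * k j) * of_real pi * \<i>"
    by metis
  have "v / v' = exp (\<Sum>j=1..m. \<rho> j * (of_int (2 * restrict k {1..m} j) * of_real pi * \<i>))"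
    unfolding l(2) l'(2) exp_diff[symmetric] sum_subtractf[symmetric]
    by (intro arg_cong[where f = exp] sum.cong refl) (simp add: k algebra_simps)
  moreover have "restrict k {1..m} \<in> {1..m} \<rightarrow>\<^sub>E UNIV" by simp
  ultimately show ?thesis unfolding weight_multipliers_def by (rule image_eqI)
qed

text \<open>
  The quotient of two branches is continuous on a connected set and has countably many
  values. The parameter \<open>t\<close> is treated like the space variable: the constant is the same for all
  times, which is where the deformation invariance comes from.
\<close>
lemma weight_branches_proportional:
  fixes f g :: "real \<times> complex \<Rightarrow> complex"
  assumes "connected S" "continuous_on S f" "continuous_on S g"
    and f: "\<And>t x. (t, x) \<in> S \<Longrightarrow> weight_value m \<rho> (\<lambda>j. a j t) x (f (t, x))"
    and g: "\<And>t x. (t, x) \<in> S \<Longrightarrow> weight_value m \<rho> (\<lambda>j. a j t) x (g (t, x))"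
  shows "\<exists>c. c \<noteq> 0 \<and> (\<forall>t x. (t, x) \<in> S \<longrightarrow> f (t, x) = c * g (t, x))"
proof (cases "S = {}")
  case True
  then show ?thesis by (intro exI[of _ 1]) auto
next
  case False
  then obtain t0 x0 where p0: "(t0, x0) \<in> S" by auto
  define h where "h p = f p / g p" for p
  have "continuous_on S h" unfolding h_def
    using assms(2,3) weight_value_nonzero[OF g] by (intro continuous_on_divide) auto
  then have conn: "connected (h ` S)" using assms(1) connected_continuous_image by blast
  have "h (t, x) \<in> weight_multipliers m \<rho>" if "(t, x) \<in> S" for t x
    unfolding h_def by (rule weight_value_ratio[OF f[OF that] g[OF that]])
  then have "h ` S \<subseteq> weight_multipliers m \<rho>" by auto
  then have "countable (h ` S)"
    using countable_weight_multipliers by (rule countable_subset)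
  then have "h p = h (t0, x0)" if "p \<in> S" for p
    using connected_uncountable[OF conn, of "h p" "h (t0, x0)"] that p0 by blast
  then have "f (t, x) = h (t0, x0) * g (t, x)" if "(t, x) \<in> S" for t x
  proof -
    have "h (t, x) = h (t0, x0)" using \<open>\<And>p. p \<in> S \<Longrightarrow> h p = h (t0, x0)\<close> that by blast
    then show ?thesis
      using weight_value_nonzero[OF g[OF that]] by (simp add: h_def[of "(t, x)"] field_simps)
  qed
  moreover have "h (t0, x0) \<noteq> 0"
    using weight_value_nonzero[OF f[OF p0]] weight_value_nonzero[OF g[OF p0]] by (simp add: h_def)
  ultimately show ?thesis by blast
qed

text \<open>
  As long as the distances from \<open>z\<close> to \<open>x\<close> and from \<open>a j t\<close> to \<open>a j t0\<close> add up to less than that from \<open>x\<close>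
  to \<open>a j t0\<close>, the quotient
  \<open>(z - a j t) / (x - a j t0)\<close> stays in the right half plane, where the principal logarithm is
  continuous.
\<close>
lemma local_weight_branch_exists:
  fixes a :: "nat \<Rightarrow> real \<Rightarrow> complex"
  assumes J: "open J" "t0 \<in> J" and a: "\<And>j. j \<in> {1..m} \<Longrightarrow> continuous_on J (a j)"
    and x: "\<And>j. j \<in> {1..m} \<Longrightarrow> x \<noteq> a j t0"
  obtains r \<eta> V where "r > 0" "\<eta> > 0" "ball t0 \<eta> \<subseteq> J"
    "continuous_on (ball t0 \<eta> \<times> ball x r) (\<lambda>(t, z). V t z)"
    "\<And>t. t \<in> ball t0 \<eta> \<Longrightarrow> V t holomorphic_on ball x r"
    "\<And>t z. t \<in> ball t0 \<eta> \<Longrightarrow> z \<in> ball x r \<Longrightarrow> weight_value m \<rho> (\<lambda>j. a j t) z (V t z)"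
proof -
  obtain R where R: "R > 0" "\<And>j. j \<in> {1..m} \<Longrightarrow> R \<le> norm (x - a j t0)"
  proof
    show "Min (insert 1 ((\<lambda>j. norm (x - a j t0)) ` {1..m})) > 0" using x by (subst Min_gr_iff) auto
    show "Min (insert 1 ((\<lambda>j. norm (x - a j t0)) ` {1..m})) \<le> norm (x - a j t0)" if "j \<in> {1..m}" for j
      using that by (intro Min_le) auto
  qed
  have "\<forall>\<^sub>F t in nhds t0. \<forall>j\<in>{1..m}. dist (a j t) (a j t0) < R / 2"
  proof (subst eventually_ball_finite_distrib)
    show "\<forall>j\<in>{1..m}. \<forall>\<^sub>F t in nhds t0. dist (a j t) (a j t0) < R / 2"
    proof
      fix j assume "j \<in> {1..m}"
      then have "isCont (a j) t0" using a J continuous_on_eq_continuous_at by blast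
      then have "(a j \<longlongrightarrow> a j t0) (nhds t0)" by (simp add: continuous_within tendsto_nhds_iff)
      then show "\<forall>\<^sub>F t in nhds t0. dist (a j t) (a j t0) < R / 2" using R(1) by (intro tendstoD) auto
    qed
  qed auto
  moreover have "\<forall>\<^sub>F t in nhds t0. t \<in> J" using J eventually_nhds_in_open by blast
  ultimately have "\<forall>\<^sub>F t in nhds t0. t \<in> J \<and> (\<forall>j\<in>{1..m}. dist (a j t) (a j t0) < R / 2)"
    by eventually_elim auto
  then obtain \<eta> where \<eta>: "\<eta> > 0" "\<And>t. dist t t0 < \<eta> \<Longrightarrow> t \<in> J \<and> (\<forall>j\<in>{1..m}. dist (a j t) (a j t0) < R / 2)"
    unfolding eventually_nhds_metric by blast
  define u where "u j t z = (z - a j t) / (x - a j t0)" for j t z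
  have u: "u j t z \<notin> \<real>\<^sub>\<le>\<^sub>0" "u j t z \<noteq> 0" if "j \<in> {1..m}" "t \<in> ball t0 \<eta>" "z \<in> ball x (R / 2)" for j t z
  proof -
    have ne: "x - a j t0 \<noteq> 0" using x that by auto
    have d1: "norm (z - x) < R / 2" using that(3) by (simp add: dist_norm norm_minus_commute)
    have d2: "norm (a j t0 - a j t) < R / 2"
      using \<eta>(2)[of t] that by (simp add: dist_commute dist_norm)
    have "norm ((z - x) + (a j t0 - a j t)) \<le> norm (z - x) + norm (a j t0 - a j t)"
      by (rule norm_triangle_ineq)
    then have "norm ((z - x) + (a j t0 - a j t)) < R" using d1 d2 by linarith
    also have "R \<le> norm (x - a j t0)" using R(2) that by blast
    finally have "norm ((z - x) + (a j t0 - a j t)) < norm (x - a j t0)" .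
    moreover have "u j t z - 1 = ((z - x) + (a j t0 - a j t)) / (x - a j t0)"
      using ne unfolding u_def by (simp add: field_simps)
    ultimately have "norm (u j t z - 1) < 1"
      using ne by (simp add: norm_divide)
    then have "Re (u j t z) > 0" using abs_Re_le_cmod[of "u j t z - 1"] by simp
    then show "u j t z \<notin> \<real>\<^sub>\<le>\<^sub>0" "u j t z \<noteq> 0" by (auto simp: complex_nonpos_Reals_iff)
  qed
  define V where "V t z = exp (\<Sum>j=1..m. \<rho> j * (Ln (x - a j t0) + Ln (u j t z)))" for t z
  show thesis
  proof (rule that[of "R / 2" \<eta> V])
    show "ball t0 \<eta> \<subseteq> J" using \<eta> by (auto simp: dist_commute)
    then have a': "continuous_on (ball t0 \<eta>) (a j)" if "j \<in> {1..m}" for j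
      using a[OF that] continuous_on_subset by blast
    have "continuous_on (ball t0 \<eta> \<times> ball x (R/2)) (\<lambda>p. u j (fst p) (snd p))" if j: "j \<in> {1..m}" for j
      unfolding u_def using x[OF j]
      by (intro continuous_intros continuous_on_compose2[OF a'[OF j]]) auto
    then show "continuous_on (ball t0 \<eta> \<times> ball x (R/2)) (\<lambda>(t, z). V t z)"
      unfolding V_def case_prod_beta using u
      by (intro continuous_intros continuous_on_Ln) (auto simp: mem_Times_iff)
    show "V t holomorphic_on ball x (R/2)" if t: "t \<in> ball t0 \<eta>" for t
    proof -
      have "u j t holomorphic_on ball x (R/2)" if "j \<in> {1..m}" for j
        unfolding u_def using x[OF that] by (intro holomorphic_intros) auto
      then show ?thesis unfolding V_def using u t
        by (intro holomorphic_intros) auto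
    qed
    show "weight_value m \<rho> (\<lambda>j. a j t) z (V t z)" if "t \<in> ball t0 \<eta>" "z \<in> ball x (R/2)" for t z
      unfolding weight_value_def V_def
    proof (intro exI[of _ "\<lambda>j. Ln (x - a j t0) + Ln (u j t z)"] conjI ballI refl)
      fix j assume j: "j \<in> {1..m}"
      then show "exp (Ln (x - a j t0) + Ln (u j t z)) = z - a j t"
        using u[OF j that] x[OF j] by (simp add: exp_add u_def)
    qed
  qed (use R \<eta> in auto)
qed

section \<open>Means over the unit circle and the Plemelj jump\<close>

text \<open>
  Normalised arc length on the unit circle is \<open>circ\<close> divided by \<open>2 \<pi>\<close>. The interval is open, so
  that \<open>cis \<theta>\<close> never hits the point \<open>-1\<close>, at which the value of the weight is arbitrary.
\<close>
definition circ :: "real measure" where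
  "circ = restrict_space lborel {- pi<..<pi}"

lemma space_circ [simp]: "space circ = {- pi<..<pi}"
  by (simp add: circ_def space_restrict_space)

lemma finite_measure_circ: "finite_measure circ"
  by (rule finite_measureI) (simp add: circ_def space_restrict_space emeasure_restrict_space)

lemma continuous_measurable_circ [intro]:
  "continuous_on UNIV f \<Longrightarrow> f \<in> borel_measurable circ" for f :: "real \<Rightarrow> 'a::topological_space"
  unfolding circ_def by (intro measurable_restrict_space1) (simp add: borel_measurable_continuous_onI)

lemma cis_measurable_circ [measurable]: "cis \<in> borel_measurable circ"
  by (intro continuous_measurable_circ) (simp add: continuous_on_cis)

lemma integrable_circ_iff:
  "integrable circ f \<longleftrightarrow> set_integrable lborel {- pi<..<pi} f" for f :: "real \<Rightarrow> complex"
  unfolding circ_def set_integrable_def by (subst integrable_restrict_space) auto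

lemma integral_circ_eq: "integral\<^sup>L circ f = (LINT \<theta>:{- pi<..<pi}|lborel. f \<theta>)" for f :: "real \<Rightarrow> complex"
  unfolding circ_def set_lebesgue_integral_def by (subst integral_restrict_space) auto

lemma circle_L1_integrable_circ: "circle_L1 f \<Longrightarrow> integrable circ (\<lambda>\<theta>. f (cis \<theta>))"
  unfolding circle_L1_def integrable_circ_iff by (rule set_integrable_subset) auto

lemma circle_mean_eq_integral:
  assumes "integrable circ (\<lambda>\<theta>. f (cis \<theta>))"
  shows "circle_mean f = integral\<^sup>L circ (\<lambda>\<theta>. f (cis \<theta>)) / (2 * pi)"
proof -
  let ?g = "\<lambda>\<theta>. f (cis \<theta>)"
  have "(?g has_integral integral\<^sup>L circ ?g) {- pi<..<pi}"
    using set_borel_integral_eq_integral[of "{- pi<..<pi}" ?g] assms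
    by (simp add: integrable_circ_iff integral_circ_eq integrable_integral)
  then have "(?g has_integral integral\<^sup>L circ ?g) {- pi..pi}"
    by (simp add: has_integral_Icc_iff_Ioo)
  then have "((\<lambda>\<theta>. ?g \<theta> / (2 * pi)) has_integral integral\<^sup>L circ ?g / (2 * pi)) {- pi..pi}"
    by (rule has_integral_divide)
  then have "((\<lambda>\<zeta>. f \<zeta> / (2 * of_real pi * \<i> * \<zeta>)) has_contour_integral integral\<^sup>L circ ?g / (2 * pi))
      (part_circlepath 0 1 (- pi) pi)"
    by (subst has_contour_integral_part_circlepath_iff) (simp_all add: field_simps)
  then show ?thesis unfolding circle_mean_def by (rule contour_integral_unique)
qed

text \<open>
  Differentiation under the integral. Cauchy's inequality turns the bound on the integrand
  into a bound on its derivative, hence on its difference quotients, and dominated convergence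
  applies.
\<close>
lemma holomorphic_on_dominated_integral:
  fixes f :: "complex \<Rightarrow> 'a \<Rightarrow> complex"
  assumes U: "open U"
    and meas: "\<And>z. z \<in> U \<Longrightarrow> f z \<in> borel_measurable M"
    and hol: "\<And>\<theta>. \<theta> \<in> space M \<Longrightarrow> (\<lambda>z. f z \<theta>) holomorphic_on U"
    and bound: "\<And>z \<theta>. z \<in> U \<Longrightarrow> \<theta> \<in> space M \<Longrightarrow> norm (f z \<theta>) \<le> B \<theta>"
    and B: "integrable M B"
  shows "(\<lambda>z. integral\<^sup>L M (f z)) holomorphic_on U"
proof -
  have intf: "integrable M (f z)" if "z \<in> U" for z
  proof (rule Bochner_Integration.integrable_bound[OF B meas[OF that]])
    show "AE \<theta> in M. norm (f z \<theta>) \<le> norm (B \<theta>)"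
      using bound[OF that] by (intro AE_I2) (metis abs_ge_self order_trans real_norm_def)
  qed
  have "(\<lambda>z. integral\<^sup>L M (f z)) field_differentiable at z0" if z0: "z0 \<in> U" for z0
  proof -
    obtain R where R: "R > 0" "cball z0 R \<subseteq> U" using U z0 open_contains_cball by blast
    define r where "r = R / 2"
    have r: "r > 0" "ball z0 r \<subseteq> U" using R unfolding r_def
      by (auto simp: subset_iff dist_norm)
    define f' where "f' \<theta> = deriv (\<lambda>z. f z \<theta>) z0" for \<theta>
    have der: "((\<lambda>z. f z \<theta>) has_field_derivative deriv (\<lambda>z. f z \<theta>) z) (at z)"
      if "\<theta> \<in> space M" "z \<in> U" for \<theta> z
      using holomorphic_derivI[OF hol[OF that(1)] U that(2)] by simp
    have der_bound: "norm (deriv (\<lambda>z. f z \<theta>) z) \<le> B \<theta> / r"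
      if "\<theta> \<in> space M" "z \<in> ball z0 r" for \<theta> z
    proof -
      have sub: "cball z r \<subseteq> U"
      proof
        fix y assume "y \<in> cball z r"
        then have "dist z0 y \<le> R" using that(2) dist_triangle[of z0 y z] by (simp add: r_def)
        then show "y \<in> U" using R by auto
      qed
      then have "(\<lambda>z. f z \<theta>) holomorphic_on cball z r" using hol[OF that(1)] holomorphic_on_subset by blast
      moreover have "norm (f y \<theta>) \<le> B \<theta>" if "norm (z - y) = r" for y
        using bound sub \<open>\<theta> \<in> space M\<close> that by (auto simp: dist_norm)
      ultimately have "norm ((deriv ^^ 1) (\<lambda>z. f z \<theta>) z) \<le> fact 1 * B \<theta> / r ^ 1"
        using r(1) by (intro Cauchy_inequality)
          (auto intro: holomorphic_on_imp_continuous_on holomorphic_on_subset[OF _ ball_subset_cball])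
      then show ?thesis by simp
    qed
    have "((\<lambda>y. (integral\<^sup>L M (f y) - integral\<^sup>L M (f z0)) / (y - z0)) \<longlongrightarrow> integral\<^sup>L M f') (at z0 within ball z0 r)"
      unfolding tendsto_at_iff_sequentially comp_def
    proof (intro allI impI)
      fix X assume X: "\<forall>i. X i \<in> ball z0 r - {z0}" "X \<longlonglongrightarrow> z0"
      define q where "q i \<theta> = (f (X i) \<theta> - f z0 \<theta>) / (X i - z0)" for i \<theta>
      have XU: "X i \<in> U" "X i \<noteq> z0" "X i \<in> ball z0 r" for i using X(1) r(2) by auto
      have q_meas: "q i \<in> borel_measurable M" for i
        unfolding q_def using meas XU(1) z0 by measurable
      have q_lim: "(\<lambda>i. q i \<theta>) \<longlonglongrightarrow> f' \<theta>" if "\<theta> \<in> space M" for \<theta>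
      proof -
        have "((\<lambda>y. (f y \<theta> - f z0 \<theta>) / (y - z0)) \<longlongrightarrow> f' \<theta>) (at z0)"
          using der[OF that z0] unfolding f'_def has_field_derivative_iff by simp
        then show ?thesis unfolding tendsto_at_iff_sequentially comp_def q_def
          using X(2) XU(2) by blast
      qed
      have q_bound: "norm (q i \<theta>) \<le> B \<theta> / r" if "\<theta> \<in> space M" for i \<theta>
      proof -
        have "norm (f (X i) \<theta> - f z0 \<theta>) \<le> B \<theta> / r * norm (X i - z0)"
          by (rule field_differentiable_bound[OF convex_ball[of z0 r], where f' = "deriv (\<lambda>z. f z \<theta>)"])
            (use that der_bound XU(3) r in \<open>auto intro!: der[THEN has_field_derivative_at_within]\<close>)
        then show ?thesis using XU(2)[of i] by (simp add: q_def norm_divide field_simps)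
      qed
      have "(\<lambda>i. integral\<^sup>L M (q i)) \<longlonglongrightarrow> integral\<^sup>L M f'"
      proof (rule integral_dominated_convergence)
        show "f' \<in> borel_measurable M" by (rule borel_measurable_LIMSEQ_metric[OF q_meas q_lim])
        show "integrable M (\<lambda>\<theta>. B \<theta> / r)" using B by simp
      qed (use q_meas q_lim q_bound in auto)
      moreover have "integral\<^sup>L M (q i) = (integral\<^sup>L M (f (X i)) - integral\<^sup>L M (f z0)) / (X i - z0)" for i
        unfolding q_def using intf[OF XU(1)] intf[OF z0] by simp
      ultimately show "(\<lambda>i. (integral\<^sup>L M (f (X i)) - integral\<^sup>L M (f z0)) / (X i - z0)) \<longlonglongrightarrow> integral\<^sup>L M f'"
        by simp
    qed
    then have "((\<lambda>z. integral\<^sup>L M (f z)) has_field_derivative integral\<^sup>L M f') (at z0)"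
      unfolding has_field_derivative_iff using r(1) by (simp add: at_within_open[of z0 "ball z0 r"])
    then show ?thesis unfolding field_differentiable_def by blast
  qed
  then show ?thesis using U by (simp add: holomorphic_on_open field_differentiable_def)
qed

lemma norm_cis_diff_ge: "\<bar>norm z - 1\<bar> \<le> norm (cis \<theta> - z)"
  using norm_triangle_ineq3[of z "cis \<theta>"] by (simp add: norm_minus_commute)

lemma integrable_cauchy_kernel:
  assumes u: "integrable circ u" and z: "norm z \<noteq> 1"
  shows "integrable circ (\<lambda>\<theta>. cis \<theta> / (cis \<theta> - z) * u \<theta>)"
proof (rule Bochner_Integration.integrable_bound)
  show "integrable circ (\<lambda>\<theta>. norm (u \<theta>) / \<bar>norm z - 1\<bar>)" using u by simp
  have [measurable]: "u \<in> borel_measurable circ" using u by simp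
  show "(\<lambda>\<theta>. cis \<theta> / (cis \<theta> - z) * u \<theta>) \<in> borel_measurable circ" by measurable
  show "AE \<theta> in circ. norm (cis \<theta> / (cis \<theta> - z) * u \<theta>) \<le> norm (norm (u \<theta>) / \<bar>norm z - 1\<bar>)"
    using norm_cis_diff_ge[of z] z
    by (intro AE_I2) (auto simp: norm_mult norm_divide intro!: frac_le)
qed

lemma integrable_circ_const: "integrable circ (\<lambda>\<theta>. c)" for c :: complex
  using finite_measure.integrable_const[OF finite_measure_circ] .

lemma integral_cauchy_kernel_outside:
  assumes "norm z > 1"
  shows "integral\<^sup>L circ (\<lambda>\<theta>. cis \<theta> / (cis \<theta> - z)) = 0"
proof -
  have "((\<lambda>\<zeta>. 1 / (2 * of_real pi * \<i> * (\<zeta> - z))) has_contour_integral 0) (part_circlepath 0 1 (- pi) pi)"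
  proof (rule Cauchy_theorem_disc_simple[of _ 0 "norm z"])
    show "(\<lambda>\<zeta>. 1 / (2 * of_real pi * \<i> * (\<zeta> - z))) holomorphic_on ball 0 (norm z)"
      by (intro holomorphic_intros) auto
    show "path_image (part_circlepath 0 1 (- pi) pi) \<subseteq> ball 0 (norm z)"
      using path_image_part_circlepath_subset'[of 1 0 "-pi" pi] assms by auto
    show "pathfinish (part_circlepath 0 1 (- pi) pi) = pathstart (part_circlepath 0 1 (- pi) pi)"
      by (simp add: exp_minus)
  qed auto
  moreover have "integrable circ (\<lambda>\<theta>. cis \<theta> / (cis \<theta> - z))"
    using integrable_cauchy_kernel[OF integrable_circ_const[of 1], of z] assms by simp
  then have "circle_mean (\<lambda>\<zeta>. \<zeta> / (\<zeta> - z)) = integral\<^sup>L circ (\<lambda>\<theta>. cis \<theta> / (cis \<theta> - z)) / (2 * pi)"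
    by (rule circle_mean_eq_integral)
  moreover have "circle_mean (\<lambda>\<zeta>. \<zeta> / (\<zeta> - z)) =
      contour_integral (part_circlepath 0 1 (- pi) pi) (\<lambda>\<zeta>. 1 / (2 * of_real pi * \<i> * (\<zeta> - z)))"
    unfolding circle_mean_def
  proof (rule contour_integral_eq)
    fix \<zeta> assume "\<zeta> \<in> path_image (part_circlepath 0 1 (- pi) pi)"
    then have "\<zeta> \<noteq> 0" using path_image_part_circlepath_subset'[of 1 0 "-pi" pi] by auto
    then show "\<zeta> / (\<zeta> - z) / (2 * of_real pi * \<i> * \<zeta>) = 1 / (2 * of_real pi * \<i> * (\<zeta> - z))" by simp
  qed
  ultimately show ?thesis using contour_integral_unique by fastforce
qed

text \<open>
  Up to the factor \<open>\<i>\<close> this is Cauchy's formula on the circle parametrised by \<open>[0, 2 \<pi>]\<close>; the shift by \<open>\<pi>\<close>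
  to \<open>[- \<pi>, \<pi>]\<close> replaces \<open>cis s\<close> by \<open>- cis s\<close> and \<open>z\<close> by \<open>- z\<close>.
\<close>
lemma integral_cauchy_kernel_inside:
  assumes "norm z < 1"
  shows "integral\<^sup>L circ (\<lambda>\<theta>. cis \<theta> / (cis \<theta> - z)) = 2 * pi"
proof -
  have "((\<lambda>\<zeta>. 1 / (\<zeta> - (- z))) has_contour_integral (2 * of_real pi * \<i> * 1)) (circlepath 0 1)"
    by (rule Cauchy_integral_circlepath_simple) (use assms in auto)
  then have "((\<lambda>s. 1 / (cis s + z) * \<i> * cis s) has_integral (2 * of_real pi * \<i>)) (cbox 0 (2 * pi))"
    unfolding circlepath_def by (simp add: has_contour_integral_part_circlepath_iff)
  from has_integral_affinity[OF this, of 1 pi]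
  have "((\<lambda>s. 1 / (cis (s + pi) + z) * \<i> * cis (s + pi)) has_integral (2 * of_real pi * \<i>)) {- pi..pi}"
    by (simp add: image_add_atLeastAtMost' del: cis_mult)
  then have "((\<lambda>s. \<i> * (cis s / (cis s - z))) has_integral (2 * of_real pi * \<i>)) {- pi..pi}"
  proof (rule has_integral_eq[rotated])
    fix s
    have "cis (s + pi) = - cis s" by (simp add: cis_mult[symmetric])
    moreover have "cis s \<noteq> z" using assms by auto
    ultimately show "1 / (cis (s + pi) + z) * \<i> * cis (s + pi) = \<i> * (cis s / (cis s - z))"
      by (simp add: divide_simps) (auto simp: algebra_simps)
  qed
  from has_integral_mult_right[OF this, of "- \<i>"]
  have "((\<lambda>s. - \<i> * (\<i> * (cis s / (cis s - z)))) has_integral (- \<i> * (2 * of_real pi * \<i>))) {- pi<..<pi}"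
    by (simp only: has_integral_Icc_iff_Ioo)
  moreover have "- \<i> * (2 * of_real pi * \<i>) = 2 * pi" by (simp add: complex_eq_iff)
  moreover have "- \<i> * (\<i> * y) = y" for y by (simp add: mult.assoc[symmetric])
  ultimately have 1: "((\<lambda>s. cis s / (cis s - z)) has_integral (2 * pi)) {- pi<..<pi}"
    by (simp only:)
  have "integrable circ (\<lambda>\<theta>. cis \<theta> / (cis \<theta> - z))"
    using integrable_cauchy_kernel[OF integrable_circ_const[of 1], of z] assms by simp
  then have "integral\<^sup>L circ (\<lambda>\<theta>. cis \<theta> / (cis \<theta> - z)) = integral {- pi<..<pi} (\<lambda>\<theta>. cis \<theta> / (cis \<theta> - z))"
    using set_borel_integral_eq_integral(2) by (simp add: integrable_circ_iff integral_circ_eq)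
  then show ?thesis using integral_unique[OF 1] by simp
qed

text \<open>
  The Plemelj jump formula for an integrable density \<open>u\<close> that is analytic on an arc. After
  subtracting \<open>g z\<close> from the density the integrand has a removable singularity on the arc, so that
  \<open>H z\<close>, the integral of \<open>cis \<theta> * (u \<theta> - g z) / (cis \<theta> - z)\<close>, is holomorphic across it. What
  has been subtracted is \<open>g z\<close> times the integral of the bare kernel, which equals one inside the
  circle and zero outside.
\<close>
lemma cauchy_integral_continuation_across_circle:
  fixes u :: "real \<Rightarrow> complex" and x :: complex
  assumes u: "integrable circ u" and g: "g holomorphic_on ball x r" and r: "r > 0"
    and arc: "\<And>\<theta>. \<theta> \<in> {- pi<..<pi} \<Longrightarrow> cis \<theta> \<in> ball x r \<Longrightarrow> u \<theta> = g (cis \<theta>)"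
  obtains H where "H holomorphic_on ball x (r / 3)"
    "\<And>z. z \<in> ball x (r / 3) \<Longrightarrow> norm z > 1 \<Longrightarrow>
       H z = integral\<^sup>L circ (\<lambda>\<theta>. cis \<theta> / (cis \<theta> - z) * u \<theta>) / (2 * pi)"
    "\<And>z. z \<in> ball x (r / 3) \<Longrightarrow> norm z < 1 \<Longrightarrow>
       H z = integral\<^sup>L circ (\<lambda>\<theta>. cis \<theta> / (cis \<theta> - z) * u \<theta>) / (2 * pi) - g z"
proof -
  \<comment> \<open>A point \<open>cis \<theta>\<close> outside \<open>ball x R\<close> is at distance at least \<open>r / 3\<close> from \<open>ball x (r / 3)\<close>.\<close>
  define R where "R = 2 * r / 3"
  have R: "R > 0" "R < r" using r by (auto simp: R_def)
  have cb: "cball x R \<subseteq> ball x r" using R by auto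
  have [measurable]: "u \<in> borel_measurable circ" using u by simp
  have "continuous_on (cball x R) g"
    using g cb by (meson continuous_on_subset holomorphic_on_imp_continuous_on)
  then have "bounded (g ` cball x R)" by (intro compact_imp_bounded compact_continuous_image compact_cball)
  then obtain G where G: "\<And>z. z \<in> cball x R \<Longrightarrow> norm (g z) \<le> G" "G > 0"
    unfolding bounded_pos by blast
  have "continuous_on (cball x R) (deriv g)"
    using holomorphic_deriv[OF g open_ball] cb by (meson continuous_on_subset holomorphic_on_imp_continuous_on)
  then have "bounded (deriv g ` cball x R)" by (intro compact_imp_bounded compact_continuous_image compact_cball)
  then obtain G' where G': "\<And>z. z \<in> cball x R \<Longrightarrow> norm (deriv g z) \<le> G'" "G' > 0"
    unfolding bounded_pos by blast
  \<comment> \<open>If \<open>cis \<theta> = z\<close> lies on the arc, \<open>q z \<theta>\<close> is the value that removes the singularity.\<close>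
  define q where "q z \<theta> = (if cis \<theta> = z then deriv g z else (u \<theta> - g z) / (cis \<theta> - z))" for z \<theta>
  define B where "B \<theta> = G' + (norm (u \<theta>) + G) * 3 / r" for \<theta>
  have sub: "ball x (r / 3) \<subseteq> ball x R" using r by (auto simp: R_def)
  have hol: "(\<lambda>z. integral\<^sup>L circ (\<lambda>\<theta>. cis \<theta> * q z \<theta>)) holomorphic_on ball x (r / 3)"
  proof (rule holomorphic_on_dominated_integral[where B = B])
    show "integrable circ B" unfolding B_def
      using u finite_measure.integrable_const[OF finite_measure_circ]
      by (intro Bochner_Integration.integrable_add integrable_divide integrable_mult_left) auto
    fix z assume z: "z \<in> ball x (r / 3)"
    show "(\<lambda>\<theta>. cis \<theta> * q z \<theta>) \<in> borel_measurable circ" unfolding q_def by measurable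
  next
    fix \<theta> assume \<theta>: "\<theta> \<in> space circ"
    show "(\<lambda>z. cis \<theta> * q z \<theta>) holomorphic_on ball x (r / 3)"
    proof (cases "cis \<theta> \<in> ball x R")
      case True
      then have uth: "u \<theta> = g (cis \<theta>)" using arc \<theta> R by auto
      have "(\<lambda>z. if z = cis \<theta> then deriv g (cis \<theta>) else (g z - g (cis \<theta>)) / (z - cis \<theta>)) holomorphic_on ball x r"
        using g by (rule pole_lemma_open) simp
      then have "(\<lambda>z. if z = cis \<theta> then deriv g (cis \<theta>) else (g z - g (cis \<theta>)) / (z - cis \<theta>)) holomorphic_on ball x (r/3)"
        by (rule holomorphic_on_subset) (use r in auto)
      then have "(\<lambda>z. q z \<theta>) holomorphic_on ball x (r / 3)"
        by (rule holomorphic_transform) (auto simp: q_def uth divide_simps, simp add: algebra_simps)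
      then show ?thesis by (intro holomorphic_intros) simp
    next
      case False
      have "(\<lambda>z. (u \<theta> - g z) / (cis \<theta> - z)) holomorphic_on ball x (r / 3)"
        using False sub r
        by (intro holomorphic_intros holomorphic_on_subset[OF g]) auto
      then have "(\<lambda>z. q z \<theta>) holomorphic_on ball x (r / 3)"
        by (rule holomorphic_transform) (use False sub in \<open>auto simp: q_def\<close>)
      then show ?thesis by (intro holomorphic_intros)
    qed
  next
    fix z \<theta> assume z: "z \<in> ball x (r / 3)" and \<theta>: "\<theta> \<in> space circ"
    have zR: "z \<in> ball x R" using z sub by blast
    have "norm (q z \<theta>) \<le> B \<theta>"
    proof (cases "cis \<theta> \<in> ball x R")
      case True
      then have uth: "u \<theta> = g (cis \<theta>)" using arc \<theta> R by auto
      have "norm (g (cis \<theta>) - g z) \<le> G' * norm (cis \<theta> - z)"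
        by (rule field_differentiable_bound[OF convex_ball[of x R], where f' = "deriv g"])
          (use True zR G' R in \<open>auto intro!: has_field_derivative_at_within holomorphic_derivI[OF g open_ball]\<close>)
      then have "norm (q z \<theta>) \<le> G'"
        using G'(1)[of z] zR by (auto simp: q_def uth norm_divide divide_simps)
      also have "G' \<le> B \<theta>" using G(2) r by (simp add: B_def)
      finally show ?thesis .
    next
      case False
      then have far: "norm (cis \<theta> - z) \<ge> r / 3" and ne: "cis \<theta> \<noteq> z"
        using z zR dist_triangle[of x "cis \<theta>" z] by (auto simp: R_def dist_norm norm_minus_commute)
      have "norm (q z \<theta>) = norm (u \<theta> - g z) / norm (cis \<theta> - z)"
        using ne by (simp add: q_def norm_divide)
      also have "\<dots> \<le> (norm (u \<theta>) + G) / (r / 3)"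
        using far r G(1)[of z] G(2) zR norm_triangle_ineq4[of "u \<theta>" "g z"] by (intro frac_le) auto
      also have "\<dots> \<le> B \<theta>" using G'(2) by (simp add: B_def)
      finally show ?thesis .
    qed
    then show "norm (cis \<theta> * q z \<theta>) \<le> B \<theta>" by (simp add: norm_mult)
  qed simp
  have split: "integral\<^sup>L circ (\<lambda>\<theta>. cis \<theta> * q z \<theta>) = integral\<^sup>L circ (\<lambda>\<theta>. cis \<theta> / (cis \<theta> - z) * u \<theta>)
      - g z * integral\<^sup>L circ (\<lambda>\<theta>. cis \<theta> / (cis \<theta> - z))" if "norm z \<noteq> 1" for z
  proof -
    have "cis \<theta> * q z \<theta> = cis \<theta> / (cis \<theta> - z) * u \<theta> - g z * (cis \<theta> / (cis \<theta> - z) * 1)" for \<theta>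
    proof -
      have "cis \<theta> \<noteq> z" using that by auto
      then show ?thesis by (simp add: q_def diff_divide_distrib right_diff_distrib mult.commute)
    qed
    then show ?thesis
      using integrable_cauchy_kernel[OF u that] integrable_cauchy_kernel[OF integrable_circ_const[of 1] that]
      by (simp only: Bochner_Integration.integral_diff integrable_mult_right integral_mult_right_zero mult_1_right)
  qed
  show thesis
  proof (rule that[of "\<lambda>z. integral\<^sup>L circ (\<lambda>\<theta>. cis \<theta> * q z \<theta>) / (2 * pi)"])
    show "(\<lambda>z. integral\<^sup>L circ (\<lambda>\<theta>. cis \<theta> * q z \<theta>) / (2 * pi)) holomorphic_on ball x (r / 3)"
      using hol by (intro holomorphic_intros) auto
  qed (simp_all add: split integral_cauchy_kernel_inside integral_cauchy_kernel_outside diff_divide_distrib)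
qed

text \<open>
  The transform that produces both numerators of the second column of \<open>Ymat\<close>.
\<close>
definition schwarz_integral :: "(complex \<Rightarrow> complex) \<Rightarrow> complex \<Rightarrow> complex" where
  "schwarz_integral f z = circle_mean (\<lambda>\<zeta>. (\<zeta> + z) / (\<zeta> - z) * f \<zeta>)"

lemma schwarz_kernel_eq:
  assumes "norm z \<noteq> 1"
  shows "(cis \<theta> + z) / (cis \<theta> - z) * c = 2 * (cis \<theta> / (cis \<theta> - z) * c) - c"
proof -
  have "cis \<theta> - z \<noteq> 0" using assms by auto
  then have "(cis \<theta> + z) / (cis \<theta> - z) = 2 * (cis \<theta> / (cis \<theta> - z)) - 1" by (simp add: field_simps)
  then show ?thesis by (simp add: left_diff_distrib)
qed

lemma integrable_schwarz_kernel:
  assumes "integrable circ u" "norm z \<noteq> 1"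
  shows "integrable circ (\<lambda>\<theta>. (cis \<theta> + z) / (cis \<theta> - z) * u \<theta>)"
  unfolding schwarz_kernel_eq[OF assms(2)]
  by (intro Bochner_Integration.integrable_diff integrable_mult_right integrable_cauchy_kernel assms)

lemma schwarz_integral_eq:
  assumes f: "integrable circ (\<lambda>\<theta>. f (cis \<theta>))" and z: "norm z \<noteq> 1"
  shows "schwarz_integral f z =
    2 * (integral\<^sup>L circ (\<lambda>\<theta>. cis \<theta> / (cis \<theta> - z) * f (cis \<theta>)) / (2 * pi))
      - integral\<^sup>L circ (\<lambda>\<theta>. f (cis \<theta>)) / (2 * pi)"
proof -
  note eq = schwarz_kernel_eq[OF z]
  note K = integrable_cauchy_kernel[OF f z]
  have K2: "integrable circ (\<lambda>\<theta>. 2 * (cis \<theta> / (cis \<theta> - z) * f (cis \<theta>)))"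
    using K by (rule integrable_mult_right)
  have "schwarz_integral f z =
      integral\<^sup>L circ (\<lambda>\<theta>. (cis \<theta> + z) / (cis \<theta> - z) * f (cis \<theta>)) / (2 * pi)"
    unfolding schwarz_integral_def by (rule circle_mean_eq_integral) (rule integrable_schwarz_kernel[OF f z])
  also have "integral\<^sup>L circ (\<lambda>\<theta>. (cis \<theta> + z) / (cis \<theta> - z) * f (cis \<theta>)) =
      2 * integral\<^sup>L circ (\<lambda>\<theta>. cis \<theta> / (cis \<theta> - z) * f (cis \<theta>)) - integral\<^sup>L circ (\<lambda>\<theta>. f (cis \<theta>))"
    unfolding eq Bochner_Integration.integral_diff[OF K2 f]
    by (simp only: integral_mult_right_zero)
  finally show ?thesis by (simp add: diff_divide_distrib)
qed

lemma schwarz_integral_continuation: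
  assumes f: "integrable circ (\<lambda>\<theta>. f (cis \<theta>))" and g: "g holomorphic_on ball x r" and r: "r > 0"
    and arc: "\<And>\<theta>. \<theta> \<in> {- pi<..<pi} \<Longrightarrow> cis \<theta> \<in> ball x r \<Longrightarrow> f (cis \<theta>) = g (cis \<theta>)"
  obtains H where "H holomorphic_on ball x (r / 3)"
    "\<And>z. z \<in> ball x (r / 3) \<Longrightarrow> norm z > 1 \<Longrightarrow> H z = schwarz_integral f z"
    "\<And>z. z \<in> ball x (r / 3) \<Longrightarrow> norm z < 1 \<Longrightarrow> H z = schwarz_integral f z - 2 * g z"
proof -
  obtain H where H: "H holomorphic_on ball x (r / 3)"
    "\<And>z. z \<in> ball x (r / 3) \<Longrightarrow> norm z > 1 \<Longrightarrow>
       H z = integral\<^sup>L circ (\<lambda>\<theta>. cis \<theta> / (cis \<theta> - z) * f (cis \<theta>)) / (2 * pi)"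
    "\<And>z. z \<in> ball x (r / 3) \<Longrightarrow> norm z < 1 \<Longrightarrow>
       H z = integral\<^sup>L circ (\<lambda>\<theta>. cis \<theta> / (cis \<theta> - z) * f (cis \<theta>)) / (2 * pi) - g z"
    using cauchy_integral_continuation_across_circle[OF f g r arc] by blast
  show thesis
    by (rule that[of "\<lambda>z. 2 * H z - integral\<^sup>L circ (\<lambda>\<theta>. f (cis \<theta>)) / (2 * pi)"])
      (use H in \<open>auto intro!: holomorphic_intros simp: schwarz_integral_eq[OF f] right_diff_distrib\<close>)
qed

lemma integrable_circ_mult_continuous:
  fixes u f :: "real \<Rightarrow> complex"
  assumes u: "integrable circ u" and f: "continuous_on UNIV f"
  shows "integrable circ (\<lambda>\<theta>. u \<theta> * f \<theta>)"
proof -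
  have [measurable]: "u \<in> borel_measurable circ" "f \<in> borel_measurable circ" using u f by auto
  have "bounded (f ` {- pi..pi})"
    using f by (intro compact_imp_bounded compact_continuous_image) (auto intro: continuous_on_subset)
  then obtain C where C: "\<And>\<theta>. \<theta> \<in> {- pi..pi} \<Longrightarrow> norm (f \<theta>) \<le> C" unfolding bounded_iff by blast
  show ?thesis
  proof (rule Bochner_Integration.integrable_bound)
    show "integrable circ (\<lambda>\<theta>. norm (u \<theta>) * C)" using u by simp
    show "AE \<theta> in circ. norm (u \<theta> * f \<theta>) \<le> norm (norm (u \<theta>) * C)"
    proof (intro AE_I2)
      fix \<theta> assume "\<theta> \<in> space circ"
      then have "norm (f \<theta>) \<le> C" using C by simp
      then have "norm (u \<theta>) * norm (f \<theta>) \<le> norm (u \<theta>) * C" by (intro mult_left_mono) auto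
      then show "norm (u \<theta> * f \<theta>) \<le> norm (norm (u \<theta>) * C)"
        by (simp add: norm_mult)
    qed
  qed measurable
qed

lemma assoc_eps_eq: "assoc_eps v p = schwarz_integral (\<lambda>\<zeta>. v \<zeta> * poly p \<zeta>)"
  by (simp add: fun_eq_iff assoc_eps_def schwarz_integral_def mult.assoc)

lemma assoc_eps_star_eq:
  "- assoc_eps_star v n q z = z ^ n * schwarz_integral (\<lambda>\<zeta>. v \<zeta> * poly q (inverse \<zeta>)) z"
  by (simp add: assoc_eps_star_def schwarz_integral_def mult.assoc)

lemma integrable_circ_weight:
  assumes "integrable circ (\<lambda>\<theta>. v (cis \<theta>))"
  shows "integrable circ (\<lambda>\<theta>. v (cis \<theta>) * poly p (cis \<theta>))"
    and "integrable circ (\<lambda>\<theta>. v (cis \<theta>) * poly q (inverse (cis \<theta>)))"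
    and "integrable circ (\<lambda>\<theta>. v (cis \<theta>) * poly p (cis \<theta>) * poly q (inverse (cis \<theta>)))"
  using integrable_circ_mult_continuous[OF assms, of "\<lambda>\<theta>. poly p (cis \<theta>)"]
    integrable_circ_mult_continuous[OF assms, of "\<lambda>\<theta>. poly q (inverse (cis \<theta>))"]
    integrable_circ_mult_continuous[OF assms, of "\<lambda>\<theta>. poly p (cis \<theta>) * poly q (inverse (cis \<theta>))"]
  by (simp_all add: mult.assoc continuous_intros continuous_on_cis continuous_on_poly)

section \<open>Local frames and their transitions\<close>

text \<open>
  A family of fundamental systems on the convex open set \<open>B\<close> for all \<open>t\<close> near \<open>t0\<close>. Its first column is \<open>X\<close>; its
  second column is \<open>H / V\<close>, where \<open>V\<close> is a branch of the weight that is continuous also in \<open>t\<close>, and \<open>H\<close>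
  is analytic across the unit circle and agrees with the given sectionally analytic function \<open>E\<close>
  outside. Inside, \<open>H\<close> and \<open>E\<close> differ by the Plemelj jump, where \<open>c * V\<close> is the weight on the
  arc in \<open>B\<close>. The constant \<open>c\<close> is the same for all \<open>t\<close>. If \<open>B\<close> does not meet the circle, no such
  arc exists, and \<open>c = 0\<close> makes \<open>H\<close> coincide with \<open>E\<close>.
\<close>
definition local_frame ::
  "nat \<Rightarrow> (nat \<Rightarrow> complex) \<Rightarrow> (nat \<Rightarrow> real \<Rightarrow> complex) \<Rightarrow> (real \<Rightarrow> 2 \<Rightarrow> complex \<Rightarrow> complex) \<Rightarrow>
   (real \<Rightarrow> 2 \<Rightarrow> complex \<Rightarrow> complex) \<Rightarrow> real \<Rightarrow> complex set \<Rightarrow> (real \<Rightarrow> complex \<Rightarrow> complex^2^2) \<Rightarrow> bool" where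
  "local_frame m \<rho> a X E t0 B F \<longleftrightarrow> open B \<and> convex B \<and>
     (\<exists>\<eta> V H c. \<eta> > 0 \<and> continuous_on (ball t0 \<eta> \<times> B) (\<lambda>(t, z). V t z) \<and>
       (\<forall>t\<in>ball t0 \<eta>. V t holomorphic_on B) \<and>
       (\<forall>t\<in>ball t0 \<eta>. \<forall>i. X t i holomorphic_on B) \<and>
       (\<forall>t\<in>ball t0 \<eta>. \<forall>i. H t i holomorphic_on B) \<and>
       (\<forall>t\<in>ball t0 \<eta>. \<forall>z\<in>B. weight_value m \<rho> (\<lambda>j. a j t) z (V t z)) \<and>
       (\<forall>t\<in>ball t0 \<eta>. \<forall>z\<in>B. \<forall>i. norm z > 1 \<longrightarrow> H t i z = E t i z) \<and>
       (\<forall>t\<in>ball t0 \<eta>. \<forall>z\<in>B. \<forall>i. norm z < 1 \<longrightarrow> H t i z = E t i z - 2 * c * V t z * X t i z) \<and>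
       (\<forall>t\<in>ball t0 \<eta>. \<forall>z\<in>B. \<forall>i. F t z $ i $ 1 = X t i z) \<and>
       (\<forall>t\<in>ball t0 \<eta>. \<forall>z\<in>B. \<forall>i. F t z $ i $ 2 = H t i z / V t z))"

lemma local_frameE:
  assumes "local_frame m \<rho> a X E t0 B F"
  obtains \<eta> V H c where "\<eta> > 0" "continuous_on (ball t0 \<eta> \<times> B) (\<lambda>(t, z). V t z)"
    "\<And>t. t \<in> ball t0 \<eta> \<Longrightarrow> V t holomorphic_on B"
    "\<And>t i. t \<in> ball t0 \<eta> \<Longrightarrow> X t i holomorphic_on B"
    "\<And>t i. t \<in> ball t0 \<eta> \<Longrightarrow> H t i holomorphic_on B"
    "\<And>t z. t \<in> ball t0 \<eta> \<Longrightarrow> z \<in> B \<Longrightarrow> weight_value m \<rho> (\<lambda>j. a j t) z (V t z)"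
    "\<And>t z i. t \<in> ball t0 \<eta> \<Longrightarrow> z \<in> B \<Longrightarrow> norm z > 1 \<Longrightarrow> H t i z = E t i z"
    "\<And>t z i. t \<in> ball t0 \<eta> \<Longrightarrow> z \<in> B \<Longrightarrow> norm z < 1 \<Longrightarrow>
       H t i z = E t i z - 2 * c * V t z * X t i z"
    "\<And>t z i. t \<in> ball t0 \<eta> \<Longrightarrow> z \<in> B \<Longrightarrow> F t z $ i $ 1 = X t i z"
    "\<And>t z i. t \<in> ball t0 \<eta> \<Longrightarrow> z \<in> B \<Longrightarrow> F t z $ i $ 2 = H t i z / V t z"
  using assms unfolding local_frame_def
proof (elim conjE exE, goal_cases)
  case (1 \<eta> V H c)
  show ?thesis by (rule that[of \<eta> V H c]; fact?) (use 1 in simp_all)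
qed

lemma local_frame_holomorphic:
  assumes "local_frame m \<rho> a X E t0 B F"
  shows "\<forall>\<^sub>F t in nhds t0. \<forall>i k. (\<lambda>z. F t z $ i $ k) holomorphic_on B"
proof (rule local_frameE[OF assms])
  fix \<eta> V H c
  assume \<eta>: "\<eta> > 0" and V: "\<And>t. t \<in> ball t0 \<eta> \<Longrightarrow> V t holomorphic_on B"
    and X: "\<And>t i. t \<in> ball t0 \<eta> \<Longrightarrow> X t i holomorphic_on B"
    and H: "\<And>t i. t \<in> ball t0 \<eta> \<Longrightarrow> H t i holomorphic_on B"
    and wv: "\<And>t z. t \<in> ball t0 \<eta> \<Longrightarrow> z \<in> B \<Longrightarrow> weight_value m \<rho> (\<lambda>j. a j t) z (V t z)"
    and F: "\<And>t z i. t \<in> ball t0 \<eta> \<Longrightarrow> z \<in> B \<Longrightarrow> F t z $ i $ 1 = X t i z"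
      "\<And>t z i. t \<in> ball t0 \<eta> \<Longrightarrow> z \<in> B \<Longrightarrow> F t z $ i $ 2 = H t i z / V t z"
  have "\<forall>\<^sub>F t in nhds t0. t \<in> ball t0 \<eta>" using \<eta> by (intro eventually_nhds_in_open) auto
  then show ?thesis
  proof eventually_elim
    case (elim t)
    have "(\<lambda>z. F t z $ i $ 1) holomorphic_on B" for i
      using X[OF elim] by (rule holomorphic_transform) (simp add: F(1)[OF elim])
    moreover have "(\<lambda>z. F t z $ i $ 2) holomorphic_on B" for i
    proof (rule holomorphic_transform)
      show "(\<lambda>z. H t i z / V t z) holomorphic_on B"
        using H[OF elim] V[OF elim] weight_value_nonzero[OF wv[OF elim]] by (rule holomorphic_on_divide)
    qed (simp add: F(2)[OF elim])
    ultimately show ?case by (simp add: forall_2)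
  qed
qed

lemma local_frame_cong:
  assumes "local_frame m \<rho> a X E t0 B F" "\<epsilon> > 0"
    and "\<And>t z. t \<in> ball t0 \<epsilon> \<Longrightarrow> z \<in> B \<Longrightarrow> F t z = F' t z"
  shows "local_frame m \<rho> a X E t0 B F'"
proof (rule local_frameE[OF assms(1)])
  fix \<eta> V H c
  assume *: "\<eta> > 0" "continuous_on (ball t0 \<eta> \<times> B) (\<lambda>(t, z). V t z)"
    "\<And>t. t \<in> ball t0 \<eta> \<Longrightarrow> V t holomorphic_on B"
    "\<And>t i. t \<in> ball t0 \<eta> \<Longrightarrow> X t i holomorphic_on B"
    "\<And>t i. t \<in> ball t0 \<eta> \<Longrightarrow> H t i holomorphic_on B"
    "\<And>t z. t \<in> ball t0 \<eta> \<Longrightarrow> z \<in> B \<Longrightarrow> weight_value m \<rho> (\<lambda>j. a j t) z (V t z)"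
    "\<And>t z i. t \<in> ball t0 \<eta> \<Longrightarrow> z \<in> B \<Longrightarrow> norm z > 1 \<Longrightarrow> H t i z = E t i z"
    "\<And>t z i. t \<in> ball t0 \<eta> \<Longrightarrow> z \<in> B \<Longrightarrow> norm z < 1 \<Longrightarrow>
       H t i z = E t i z - 2 * c * V t z * X t i z"
    "\<And>t z i. t \<in> ball t0 \<eta> \<Longrightarrow> z \<in> B \<Longrightarrow> F t z $ i $ 1 = X t i z"
    "\<And>t z i. t \<in> ball t0 \<eta> \<Longrightarrow> z \<in> B \<Longrightarrow> F t z $ i $ 2 = H t i z / V t z"
  define \<delta> where "\<delta> = min \<eta> \<epsilon>"
  have \<delta>: "\<delta> > 0" "\<And>t. t \<in> ball t0 \<delta> \<Longrightarrow> t \<in> ball t0 \<eta>" "\<And>t. t \<in> ball t0 \<delta> \<Longrightarrow> t \<in> ball t0 \<epsilon>"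
    using *(1) assms(2) by (auto simp: \<delta>_def)
  show ?thesis unfolding local_frame_def
  proof (intro conjI exI[of _ \<delta>] exI[of _ V] exI[of _ H] exI[of _ c] ballI allI impI)
    show "open B" "convex B" using assms(1) unfolding local_frame_def by blast+
    show "continuous_on (ball t0 \<delta> \<times> B) (\<lambda>(t, z). V t z)"
      using *(2) by (rule continuous_on_subset) (use \<delta>(2) in blast)
    fix t assume t': "t \<in> ball t0 \<delta>"
    note t = \<delta>(2)[OF t']
    show "V t holomorphic_on B" using *(3)[OF t] .
    show "X t i holomorphic_on B" "H t i holomorphic_on B" for i using *(4,5)[OF t] .
    fix z assume z: "z \<in> B"
    show "weight_value m \<rho> (\<lambda>j. a j t) z (V t z)" using *(6)[OF t z] .
    fix i
    show "H t i z = E t i z" if "norm z > 1" using *(7)[OF t z that] .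
    show "H t i z = E t i z - 2 * c * V t z * X t i z" if "norm z < 1" using *(8)[OF t z that] .
    show "F' t z $ i $ 1 = X t i z" "F' t z $ i $ 2 = H t i z / V t z"
      using *(9,10)[OF t z] assms(3)[OF \<delta>(3)[OF t'] z] by simp_all
  qed (rule \<delta>(1))
qed

text \<open>
  The overlap is connected, so it suffices to compare the two frames on its part
  outside the circle or on its part inside. Outside, the functions \<open>H\<close> and \<open>H'\<close> agree.
  Inside, they differ by the difference of two jumps, a constant multiple of \<open>V' * X\<close>, since \<open>V\<close>
  and \<open>V'\<close> are proportional. In both cases the constants involved do not depend on \<open>t\<close>.
\<close>
lemma local_frame_transition:
  assumes "local_frame m \<rho> a X E t0 B F" "local_frame m \<rho> a X E t0 B' F'"
  shows "\<exists>N. \<forall>\<^sub>F t in nhds t0. \<forall>z\<in>B \<inter> B'. F t z = F' t z ** N"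
proof (cases "B \<inter> B' = {}")
  case True
  then show ?thesis by simp
next
  case ne: False
  define O' where "O' = B \<inter> B'"
  have O': "open O'" "convex O'" "O' \<noteq> {}" "O' \<subseteq> B" "O' \<subseteq> B'"
    using assms ne unfolding O'_def local_frame_def by (auto intro: convex_Int)
  obtain \<eta> V H c where \<eta>: "\<eta> > 0" and V_cont: "continuous_on (ball t0 \<eta> \<times> B) (\<lambda>(t, z). V t z)"
    and V: "\<And>t. t \<in> ball t0 \<eta> \<Longrightarrow> V t holomorphic_on B"
    and X: "\<And>t i. t \<in> ball t0 \<eta> \<Longrightarrow> X t i holomorphic_on B"
    and H: "\<And>t i. t \<in> ball t0 \<eta> \<Longrightarrow> H t i holomorphic_on B"
    and wv: "\<And>t z. t \<in> ball t0 \<eta> \<Longrightarrow> z \<in> B \<Longrightarrow> weight_value m \<rho> (\<lambda>j. a j t) z (V t z)"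
    and out: "\<And>t z i. t \<in> ball t0 \<eta> \<Longrightarrow> z \<in> B \<Longrightarrow> norm z > 1 \<Longrightarrow> H t i z = E t i z"
    and ins: "\<And>t z i. t \<in> ball t0 \<eta> \<Longrightarrow> z \<in> B \<Longrightarrow> norm z < 1 \<Longrightarrow>
       H t i z = E t i z - 2 * c * V t z * X t i z"
    and F: "\<And>t z i. t \<in> ball t0 \<eta> \<Longrightarrow> z \<in> B \<Longrightarrow> F t z $ i $ 1 = X t i z"
      "\<And>t z i. t \<in> ball t0 \<eta> \<Longrightarrow> z \<in> B \<Longrightarrow> F t z $ i $ 2 = H t i z / V t z"
    by (rule local_frameE[OF assms(1)]) (rule that)
  obtain \<eta>' V' H' c' where \<eta>': "\<eta>' > 0" and V'_cont: "continuous_on (ball t0 \<eta>' \<times> B') (\<lambda>(t, z). V' t z)"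
    and V': "\<And>t. t \<in> ball t0 \<eta>' \<Longrightarrow> V' t holomorphic_on B'"
    and H': "\<And>t i. t \<in> ball t0 \<eta>' \<Longrightarrow> H' t i holomorphic_on B'"
    and wv': "\<And>t z. t \<in> ball t0 \<eta>' \<Longrightarrow> z \<in> B' \<Longrightarrow> weight_value m \<rho> (\<lambda>j. a j t) z (V' t z)"
    and out': "\<And>t z i. t \<in> ball t0 \<eta>' \<Longrightarrow> z \<in> B' \<Longrightarrow> norm z > 1 \<Longrightarrow> H' t i z = E t i z"
    and ins': "\<And>t z i. t \<in> ball t0 \<eta>' \<Longrightarrow> z \<in> B' \<Longrightarrow> norm z < 1 \<Longrightarrow>
       H' t i z = E t i z - 2 * c' * V' t z * X t i z"
    and F': "\<And>t z i. t \<in> ball t0 \<eta>' \<Longrightarrow> z \<in> B' \<Longrightarrow> F' t z $ i $ 1 = X t i z"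
      "\<And>t z i. t \<in> ball t0 \<eta>' \<Longrightarrow> z \<in> B' \<Longrightarrow> F' t z $ i $ 2 = H' t i z / V' t z"
    by (rule local_frameE[OF assms(2)]) (rule that)
  define \<eta>0 where "\<eta>0 = min \<eta> \<eta>'"
  have \<eta>0: "\<eta>0 > 0" "ball t0 \<eta>0 \<subseteq> ball t0 \<eta>" "ball t0 \<eta>0 \<subseteq> ball t0 \<eta>'"
    using \<eta> \<eta>' by (auto simp: \<eta>0_def)
  have "\<exists>\<mu>. \<mu> \<noteq> 0 \<and> (\<forall>t z. (t, z) \<in> ball t0 \<eta>0 \<times> O' \<longrightarrow>
      (\<lambda>(t, z). V t z) (t, z) = \<mu> * (\<lambda>(t, z). V' t z) (t, z))"
  proof (rule weight_branches_proportional[where m = m and \<rho> = \<rho> and a = a])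
    show "connected (ball t0 \<eta>0 \<times> O')"
      by (intro convex_connected convex_Times O' convex_ball)
    show "continuous_on (ball t0 \<eta>0 \<times> O') (\<lambda>(t, z). V t z)"
      using V_cont by (rule continuous_on_subset) (use \<eta>0 O' in blast)
    show "continuous_on (ball t0 \<eta>0 \<times> O') (\<lambda>(t, z). V' t z)"
      using V'_cont by (rule continuous_on_subset) (use \<eta>0 O' in blast)
  qed (use wv wv' \<eta>0 O' in \<open>auto simp: subset_iff\<close>)
  then obtain \<mu> where \<mu>: "\<mu> \<noteq> 0" "\<And>t z. t \<in> ball t0 \<eta>0 \<Longrightarrow> z \<in> O' \<Longrightarrow> V t z = \<mu> * V' t z" by auto
  have V'_nz: "V' t z \<noteq> 0" if "t \<in> ball t0 \<eta>0" "z \<in> O'" for t z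
    using weight_value_nonzero[OF wv'] that \<eta>0(3) O'(5) by blast
  have ev: "\<forall>\<^sub>F t in nhds t0. t \<in> ball t0 \<eta>0" using \<eta>0(1) by (intro eventually_nhds_in_open) auto
  \<comment> \<open>It is enough to compare the two continuations on a nonempty open part of the overlap.\<close>
  have identity: "f z = g z"
    if "f holomorphic_on O'" "g holomorphic_on O'" "open S" "S \<inter> O' \<noteq> {}" "z \<in> O'"
      "\<And>y. y \<in> S \<inter> O' \<Longrightarrow> f y = g y" for f g :: "complex \<Rightarrow> complex" and S z
    by (rule analytic_continuation_open[of "S \<inter> O'" O' f g])
      (use that O' in \<open>auto simp: convex_connected\<close>)
  have hol: "X t i holomorphic_on O'" "H t i holomorphic_on O'" "H' t i holomorphic_on O'"
    "V t holomorphic_on O'" "V' t holomorphic_on O'"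
    if "t \<in> ball t0 \<eta>0" for t i
    using that \<eta>0 O'(4,5) X H H' V V' by (blast intro: holomorphic_on_subset)+
  have "\<exists>b. \<forall>t\<in>ball t0 \<eta>0. \<forall>z\<in>O'. \<forall>i. H t i z = H' t i z + b * V' t z * X t i z"
  proof (cases "\<exists>z\<in>O'. norm z > 1")
    case True
    have op: "open {z::complex. norm z > 1}" by (intro open_Collect_less continuous_intros)
    have "H t i z = H' t i z" if "t \<in> ball t0 \<eta>0" "z \<in> O'" for t z i
      by (rule identity[OF hol(2,3)[OF that(1)] op])
        (use True that out out' \<eta>0 O' in \<open>auto simp: subset_iff\<close>)
    then show ?thesis by (intro exI[of _ 0]) auto
  next
    case False
    have "\<exists>z\<in>O'. norm z < 1"
    proof -
      \<comment> \<open>An open set inside the closed disc contains points shrunk towards the origin.\<close>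
      obtain z where "z \<in> O'" using O'(3) by auto
      with O'(1) obtain e where z: "z \<in> O'" "e > 0" "ball z e \<subseteq> O'"
        by (auto simp: open_contains_ball)
      define d where "d = min (e / 2) (1 / 2)"
      have d: "d > 0" "d < e" "d < 1" using z(2) by (auto simp: d_def)
      have "norm z \<le> 1" using False z(1) not_le by blast
      then have "d * norm z < e" using d mult_left_le[of "norm z" d] by linarith
      moreover have "z - of_real (1 - d) * z = of_real d * z" by (simp add: algebra_simps)
      ultimately have "of_real (1 - d) * z \<in> ball z e"
        using d by (simp add: dist_norm norm_mult)
      moreover have "(1 - d) * norm z \<le> 1 - d" using \<open>norm z \<le> 1\<close> d by (simp add: mult_left_le)
      then have "norm (of_real (1 - d) * z) < 1" using d by (simp only: norm_mult norm_of_real)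
      ultimately show ?thesis using z(3) by blast
    qed
    then have ne': "{z. norm z < 1} \<inter> O' \<noteq> {}" by auto
    have op: "open {z::complex. norm z < 1}" by (intro open_Collect_less continuous_intros)
    have "H t i z = H' t i z + (2 * c' - 2 * c * \<mu>) * V' t z * X t i z"
      if "t \<in> ball t0 \<eta>0" "z \<in> O'" for t z i
    proof (rule identity[OF _ _ op ne' that(2)])
      show "(\<lambda>z. H' t i z + (2 * c' - 2 * c * \<mu>) * V' t z * X t i z) holomorphic_on O'"
        by (intro holomorphic_intros hol that)
      fix y assume y: "y \<in> {z. norm z < 1} \<inter> O'"
      then have "H t i y = E t i y - 2 * c * V t y * X t i y"
        "H' t i y = E t i y - 2 * c' * V' t y * X t i y"
        using ins ins' that(1) \<eta>0 O' by (auto simp: subset_iff)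
      then show "H t i y = H' t i y + (2 * c' - 2 * c * \<mu>) * V' t y * X t i y"
        using \<mu>(2)[OF that(1)] y by (simp add: algebra_simps)
    qed (rule hol[OF that(1)])
    then show ?thesis by blast
  qed
  then obtain b where b: "\<And>t z i. t \<in> ball t0 \<eta>0 \<Longrightarrow> z \<in> O' \<Longrightarrow> H t i z = H' t i z + b * V' t z * X t i z"
    by blast
  define N :: "complex^2^2" where "N = vector [vector [1, b / \<mu>], vector [0, 1 / \<mu>]]"
  have "\<forall>\<^sub>F t in nhds t0. \<forall>z\<in>B \<inter> B'. F t z = F' t z ** N"
    using ev
  proof eventually_elim
    case (elim t)
    show ?case unfolding O'_def[symmetric]
    proof
      fix z assume z: "z \<in> O'"
      have tz: "t \<in> ball t0 \<eta>" "t \<in> ball t0 \<eta>'" "z \<in> B" "z \<in> B'"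
        using elim z \<eta>0 O' by auto
      have "F t z $ i $ k = (F' t z ** N) $ i $ k" for i k
      proof -
        have "H t i z / V t z = X t i z * (b / \<mu>) + H' t i z / V' t z * (1 / \<mu>)"
          using \<mu>(1) \<mu>(2)[OF elim z] V'_nz[OF elim z] b[OF elim z, of i]
          by (simp add: field_simps)
        then have "k = 1 \<or> k = 2 \<Longrightarrow> ?thesis"
          by (auto simp: matrix_matrix_mult_def sum_2 N_def F[OF tz(1,3)] F'[OF tz(2,4)])
        then show ?thesis using exhaust_2[of k] by blast
      qed
      then show "F t z = F' t z ** N" by (simp add: Finite_Cartesian_Product.vec_eq_iff)
    qed
  qed
  then show ?thesis by blast
qed

section \<open>Frames for the matrix $Y_n$\<close>

definition Y_column1 :: "complex poly \<Rightarrow> complex poly \<Rightarrow> 2 \<Rightarrow> complex \<Rightarrow> complex" where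
  "Y_column1 p q i z = (if i = 1 then poly p z else poly (reflect_poly q) z)"

definition Y_column2_numerator ::
  "(complex \<Rightarrow> complex) \<Rightarrow> nat \<Rightarrow> complex poly \<Rightarrow> complex poly \<Rightarrow> 2 \<Rightarrow> complex \<Rightarrow> complex" where
  "Y_column2_numerator v n p q i z = (if i = 1 then assoc_eps v p z else - assoc_eps_star v n q z)"

lemma Ymat_nth:
  "Ymat v n p q z $ i $ 1 = Y_column1 p q i z"
  "Ymat v n p q z $ i $ 2 = Y_column2_numerator v n p q i z / v z"
  using exhaust_2[of i] by (auto simp: Ymat_def Y_column1_def Y_column2_numerator_def)

text \<open>
  Both rows have the jump \<open>2 * c * V\<close> times the first column: for the second row the density
  on the circle is \<open>v \<zeta> * poly q (1 / \<zeta>)\<close>, and the factor \<open>z ^ n\<close> in front turns \<open>poly q (1 / z)\<close> into the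
  reciprocal polynomial. As \<open>poly q (1 / z)\<close> is singular at the origin, a ball around the origin
  must have \<open>c = 0\<close>.
\<close>
lemma Y_column2_continuation:
  assumes v: "integrable circ (\<lambda>\<theta>. v (cis \<theta>))" and V: "V holomorphic_on ball x r" and r: "r > 0"
    and arc: "\<And>\<theta>. \<theta> \<in> {- pi<..<pi} \<Longrightarrow> cis \<theta> \<in> ball x r \<Longrightarrow> v (cis \<theta>) = c * V (cis \<theta>)"
    and c: "c = 0 \<or> 0 \<notin> ball x r" and q: "degree q = n"
  obtains H :: "2 \<Rightarrow> complex \<Rightarrow> complex" where
    "\<And>i. H i holomorphic_on ball x (r / 3)"
    "\<And>i z. z \<in> ball x (r / 3) \<Longrightarrow> norm z > 1 \<Longrightarrow> H i z = Y_column2_numerator v n p q i z"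
    "\<And>i z. z \<in> ball x (r / 3) \<Longrightarrow> norm z < 1 \<Longrightarrow>
       H i z = Y_column2_numerator v n p q i z - 2 * c * V z * Y_column1 p q i z"
proof -
  obtain H1 where H1: "H1 holomorphic_on ball x (r / 3)"
    "\<And>z. z \<in> ball x (r / 3) \<Longrightarrow> norm z > 1 \<Longrightarrow> H1 z = schwarz_integral (\<lambda>\<zeta>. v \<zeta> * poly p \<zeta>) z"
    "\<And>z. z \<in> ball x (r / 3) \<Longrightarrow> norm z < 1 \<Longrightarrow>
       H1 z = schwarz_integral (\<lambda>\<zeta>. v \<zeta> * poly p \<zeta>) z - 2 * (c * V z * poly p z)"
  proof (rule schwarz_integral_continuation[of "\<lambda>\<zeta>. v \<zeta> * poly p \<zeta>" "\<lambda>z. c * V z * poly p z" x r])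
    show "integrable circ (\<lambda>\<theta>. v (cis \<theta>) * poly p (cis \<theta>))" using v by (rule integrable_circ_weight)
    show "(\<lambda>z. c * V z * poly p z) holomorphic_on ball x r" by (intro holomorphic_intros V)
  qed (use arc r that in auto)
  obtain H2 where H2: "H2 holomorphic_on ball x (r / 3)"
    "\<And>z. z \<in> ball x (r / 3) \<Longrightarrow> norm z > 1 \<Longrightarrow> H2 z = schwarz_integral (\<lambda>\<zeta>. v \<zeta> * poly q (inverse \<zeta>)) z"
    "\<And>z. z \<in> ball x (r / 3) \<Longrightarrow> norm z < 1 \<Longrightarrow>
       H2 z = schwarz_integral (\<lambda>\<zeta>. v \<zeta> * poly q (inverse \<zeta>)) z - 2 * (c * V z * poly q (inverse z))"
  proof (rule schwarz_integral_continuation[of "\<lambda>\<zeta>. v \<zeta> * poly q (inverse \<zeta>)" "\<lambda>z. c * V z * poly q (inverse z)" x r])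
    show "integrable circ (\<lambda>\<theta>. v (cis \<theta>) * poly q (inverse (cis \<theta>)))" using v by (rule integrable_circ_weight)
    show "(\<lambda>z. c * V z * poly q (inverse z)) holomorphic_on ball x r"
    proof (cases "c = 0")
      case False
      with c have "z \<noteq> 0" if "z \<in> ball x r" for z using that by auto
      then show ?thesis by (intro holomorphic_intros V) auto
    qed simp
  qed (use arc r that in auto)
  show thesis
  proof (rule that[of "\<lambda>i z. if i = 1 then H1 z else z ^ n * H2 z"])
    show "(\<lambda>z. if i = 1 then H1 z else z ^ n * H2 z) holomorphic_on ball x (r / 3)" for i :: 2
      using H1(1) H2(1) by (cases "i = 1") (auto intro!: holomorphic_intros)
    fix i :: 2 and z assume z: "z \<in> ball x (r / 3)"
    show "(if i = 1 then H1 z else z ^ n * H2 z) = Y_column2_numerator v n p q i z" if "norm z > 1"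
      using H1(2)[OF z that] H2(2)[OF z that]
      by (simp add: Y_column2_numerator_def assoc_eps_eq assoc_eps_star_eq)
    show "(if i = 1 then H1 z else z ^ n * H2 z) =
        Y_column2_numerator v n p q i z - 2 * c * V z * Y_column1 p q i z" if "norm z < 1"
    proof -
      have "c * (z ^ n * poly q (inverse z)) = c * poly (reflect_poly q) z"
      proof (cases "c = 0")
        case False
        then have "z \<noteq> 0" using c z r by auto
        then show ?thesis by (simp add: poly_reflect_poly_nz q)
      qed simp
      then have "z ^ n * (2 * (c * (V z * poly q (inverse z)))) = 2 * (c * (V z * poly (reflect_poly q) z))"
        by (metis (no_types, opaque_lifting) mult.assoc mult.commute)
      then show ?thesis using H1(3)[OF z that] H2(3)[OF z that]
        by (simp add: Y_column1_def Y_column2_numerator_def assoc_eps_eq assoc_eps_star_eq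
            right_diff_distrib mult.assoc)
    qed
  qed
qed

locale deformed_weight =
  fixes J :: "real set" and m :: nat and \<rho> :: "nat \<Rightarrow> complex" and a :: "nat \<Rightarrow> real \<Rightarrow> complex"
    and D :: "real \<Rightarrow> complex set" and w :: "real \<Rightarrow> complex \<Rightarrow> complex"
  assumes open_J: "open J"
    and a_cont: "\<And>j. j \<in> {1..m} \<Longrightarrow> continuous_on J (a j)"
    and w_branch: "\<And>t. t \<in> J \<Longrightarrow> weight_branch m \<rho> (\<lambda>j. a j t) (D t) (w t)"
    and w_circle: "\<And>t. t \<in> J \<Longrightarrow> sphere 0 1 - {-1} - (\<lambda>j. a j t) ` {1..m} \<subseteq> D t"
    and cuts_cont: "open {(t, x). t \<in> J \<and> x \<in> D t}"
    and w_cont: "continuous_on {(t, x). t \<in> J \<and> x \<in> D t} (\<lambda>(t, x). w t x)"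
    and w_match: "\<And>t. t \<in> J \<Longrightarrow>
          \<exists>L. ((\<lambda>\<theta>. w t (cis \<theta>)) \<longlongrightarrow> L) (at_left pi) \<and> ((\<lambda>\<theta>. w t (cis \<theta>)) \<longlongrightarrow> L) (at_right (- pi))"
    and w_integrable: "\<And>t. t \<in> J \<Longrightarrow> integrable circ (\<lambda>\<theta>. w t (cis \<theta>))"
begin

lemma weight_value_D: "t \<in> J \<Longrightarrow> z \<in> D t \<Longrightarrow> weight_value m \<rho> (\<lambda>j. a j t) z (w t z)"
  using w_branch unfolding weight_branch_def weight_value_def by blast

text \<open>
  On the arcs of the circle that avoid \<open>-1\<close> the weight is a branch, hence proportional to \<open>V\<close>. If \<open>x\<close> is
  the point \<open>-1\<close> there are two such arcs in the ball; the one-sided limits of the weight at \<open>-1\<close>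
  agree and \<open>V\<close> is continuous and nonzero there, so the two constants are equal. The arcs are
  parametrised as \<open>x * cis \<psi>\<close> with \<open>\<psi>\<close> near zero, which treats all points \<open>x\<close> alike.
\<close>
lemma weight_proportional_on_circle:
  assumes x: "norm x = 1" and r0: "r0 > 0" and \<eta>: "\<eta> > 0" "ball t0 \<eta> \<subseteq> J"
    and V_cont: "continuous_on (ball t0 \<eta> \<times> ball x r0) (\<lambda>(t, z). V t z)"
    and V_hol: "\<And>t. t \<in> ball t0 \<eta> \<Longrightarrow> V t holomorphic_on ball x r0"
    and wv: "\<And>t z. t \<in> ball t0 \<eta> \<Longrightarrow> z \<in> ball x r0 \<Longrightarrow> weight_value m \<rho> (\<lambda>j. a j t) z (V t z)"
  obtains r c where "r > 0"
    "\<And>t \<theta>. t \<in> ball t0 \<eta> \<Longrightarrow> \<theta> \<in> {- pi<..<pi} \<Longrightarrow> cis \<theta> \<in> ball x r \<Longrightarrow> w t (cis \<theta>) = c * V t (cis \<theta>)"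
proof -
  have x0: "x \<noteq> 0" using x by auto
  \<comment> \<open>The ball of radius \<open>r1\<close> contains the point \<open>-1\<close> only if that point is its centre.\<close>
  define r1 where "r1 = (if x = -1 then r0 else min r0 (dist x (-1)))"
  have r1: "r1 > 0" "r1 \<le> r0" "x \<noteq> -1 \<Longrightarrow> r1 \<le> dist x (-1)" using r0 by (auto simp: r1_def)
  have cis_cont: "isCont cis s" for s
    using continuous_on_cis[of UNIV "\<lambda>\<psi>. \<psi>"] by (simp add: continuous_on_eq_continuous_at)
  have "((\<lambda>\<psi>. x * cis \<psi>) \<longlongrightarrow> x * cis 0) (nhds 0)"
    using cis_cont[of 0] by (intro tendsto_mult tendsto_const) (simp only: isCont_def tendsto_nhds_iff)
  then have "\<forall>\<^sub>F \<psi> in nhds 0. dist (x * cis \<psi>) x < r1" using tendstoD r1(1) by fastforce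
  then obtain \<psi>1 where \<psi>1: "\<psi>1 > 0" "\<And>\<psi>. \<bar>\<psi>\<bar> < \<psi>1 \<Longrightarrow> dist (x * cis \<psi>) x < r1"
    unfolding eventually_nhds_metric by (auto simp: dist_real_def)
  define \<psi>0 where "\<psi>0 = min \<psi>1 pi"
  have \<psi>0: "\<psi>0 > 0" "\<psi>0 \<le> pi" "\<And>\<psi>. \<bar>\<psi>\<bar> < \<psi>0 \<Longrightarrow> x * cis \<psi> \<in> ball x r1"
    using \<psi>1 by (auto simp: \<psi>0_def dist_commute)
  have arc_const: "\<exists>c. \<forall>t\<in>ball t0 \<eta>. \<forall>\<psi>\<in>\<Psi>. w t (x * cis \<psi>) = c * V t (x * cis \<psi>)"
    if \<Psi>: "connected \<Psi>" "\<Psi> \<subseteq> {-\<psi>0<..<\<psi>0}" "\<And>\<psi>. \<psi> \<in> \<Psi> \<Longrightarrow> x * cis \<psi> \<noteq> -1" for \<Psi>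
  proof -
    define A where "A = (\<lambda>\<psi>. x * cis \<psi>) ` \<Psi>"
    have A_ball: "A \<subseteq> ball x r0" unfolding A_def
    proof
      fix y assume "y \<in> (\<lambda>\<psi>. x * cis \<psi>) ` \<Psi>"
      then obtain \<psi> where "\<psi> \<in> \<Psi>" "y = x * cis \<psi>" by blast
      moreover from this have "\<bar>\<psi>\<bar> < \<psi>0" using \<Psi>(2) by (auto simp: abs_less_iff)
      ultimately show "y \<in> ball x r0" using \<psi>0(3)[of \<psi>] r1(2) by simp
    qed
    have A_D: "A \<subseteq> D t" if "t \<in> ball t0 \<eta>" for t
    proof
      fix y assume y: "y \<in> A"
      have "y \<noteq> a j t" if "j \<in> {1..m}" for j
        using weight_value_not_singular[OF wv[OF \<open>t \<in> ball t0 \<eta>\<close>]] y A_ball that by blast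
      then have "y \<notin> (\<lambda>j. a j t) ` {1..m}" by blast
      moreover have "norm y = 1" "y \<noteq> -1" using y \<Psi>(3) x by (auto simp: A_def norm_mult)
      ultimately have "y \<in> sphere 0 1 - {-1} - (\<lambda>j. a j t) ` {1..m}" by simp
      then show "y \<in> D t" using w_circle that \<eta>(2) by blast
    qed
    have in_D: "t \<in> J \<and> z \<in> D t" if "t \<in> ball t0 \<eta>" "z \<in> A" for t z
      using A_D[OF that(1)] that \<eta>(2) by blast
    have "\<exists>c. c \<noteq> 0 \<and> (\<forall>t z. (t, z) \<in> ball t0 \<eta> \<times> A \<longrightarrow> (\<lambda>(t, z). w t z) (t, z) = c * (\<lambda>(t, z). V t z) (t, z))"
    proof (rule weight_branches_proportional[where m = m and \<rho> = \<rho> and a = a])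
      have "connected A" unfolding A_def
        using \<Psi>(1) by (intro connected_continuous_image continuous_intros continuous_on_cis)
      then show "connected (ball t0 \<eta> \<times> A)" by (intro connected_Times) auto
      show "continuous_on (ball t0 \<eta> \<times> A) (\<lambda>(t, z). w t z)"
        using w_cont by (rule continuous_on_subset) (use in_D in auto)
      show "continuous_on (ball t0 \<eta> \<times> A) (\<lambda>(t, z). V t z)"
        using V_cont by (rule continuous_on_subset) (use A_ball in auto)
      fix t z assume "(t, z) \<in> ball t0 \<eta> \<times> A"
      then have "t \<in> ball t0 \<eta>" "z \<in> A" by auto
      then show "weight_value m \<rho> (\<lambda>j. a j t) z ((\<lambda>(t, z). w t z) (t, z))"
        "weight_value m \<rho> (\<lambda>j. a j t) z ((\<lambda>(t, z). V t z) (t, z))"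
        using weight_value_D[of t z] wv[of t z] in_D[of t z] A_ball by auto
    qed
    then obtain c where c: "\<And>t z. t \<in> ball t0 \<eta> \<Longrightarrow> z \<in> A \<Longrightarrow> w t z = c * V t z" by auto
    show ?thesis by (intro exI[of _ c] ballI c) (auto simp: A_def)
  qed
  have "\<exists>c. \<forall>t\<in>ball t0 \<eta>. \<forall>\<psi>. \<bar>\<psi>\<bar> < \<psi>0 \<longrightarrow> x * cis \<psi> \<noteq> -1 \<longrightarrow> w t (x * cis \<psi>) = c * V t (x * cis \<psi>)"
  proof (cases "x = -1")
    case False
    have "x * cis \<psi> \<noteq> -1" if "\<bar>\<psi>\<bar> < \<psi>0" for \<psi>
      using \<psi>0(3)[OF that] r1(3)[OF False] by auto
    then have "\<exists>c. \<forall>t\<in>ball t0 \<eta>. \<forall>\<psi>\<in>{-\<psi>0<..<\<psi>0}. w t (x * cis \<psi>) = c * V t (x * cis \<psi>)"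
      by (intro arc_const) auto
    then show ?thesis by (auto simp: abs_less_iff)
  next
    case True
    have cis_ne_1: "cis \<psi> \<noteq> 1" if "\<bar>\<psi>\<bar> < \<psi>0" "\<psi> \<noteq> 0" for \<psi>
    proof
      assume "cis \<psi> = 1"
      then have "cos \<psi> = 1" by (simp add: complex_eq_iff)
      then have "cos \<bar>\<psi>\<bar> = cos 0" by simp
      then show False using cos_inj_pi[of "\<bar>\<psi>\<bar>" 0] that \<psi>0(2) by simp
    qed
    have "\<exists>c. \<forall>t\<in>ball t0 \<eta>. \<forall>\<psi>\<in>{0<..<\<psi>0}. w t (x * cis \<psi>) = c * V t (x * cis \<psi>)"
      by (rule arc_const) (use True cis_ne_1 \<psi>0 in \<open>auto simp: abs_less_iff\<close>)
    then obtain c where c: "\<And>t \<psi>. t \<in> ball t0 \<eta> \<Longrightarrow> 0 < \<psi> \<Longrightarrow> \<psi> < \<psi>0 \<Longrightarrow> w t (x * cis \<psi>) = c * V t (x * cis \<psi>)"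
      by (meson greaterThanLessThan_iff)
    have "\<exists>c. \<forall>t\<in>ball t0 \<eta>. \<forall>\<psi>\<in>{-\<psi>0<..<0}. w t (x * cis \<psi>) = c * V t (x * cis \<psi>)"
      by (rule arc_const) (use True cis_ne_1 \<psi>0 in \<open>auto simp: abs_less_iff\<close>)
    then obtain c' where c': "\<And>t \<psi>. t \<in> ball t0 \<eta> \<Longrightarrow> -\<psi>0 < \<psi> \<Longrightarrow> \<psi> < 0 \<Longrightarrow> w t (x * cis \<psi>) = c' * V t (x * cis \<psi>)"
      by (meson greaterThanLessThan_iff)
    have t0: "t0 \<in> ball t0 \<eta>" "t0 \<in> J" using \<eta> by auto
    obtain L where L: "((\<lambda>\<theta>. w t0 (cis \<theta>)) \<longlongrightarrow> L) (at_left pi)" "((\<lambda>\<theta>. w t0 (cis \<theta>)) \<longlongrightarrow> L) (at_right (- pi))"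
      using w_match[OF t0(2)] by blast
    have V_lim: "((\<lambda>\<theta>. V t0 (cis \<theta>)) \<longlongrightarrow> V t0 (-1)) (at \<theta>0 within S)" if "cis \<theta>0 = -1" for \<theta>0 S
    proof -
      have "isCont (V t0) (cis \<theta>0)"
        using holomorphic_on_imp_continuous_on[OF V_hol[OF t0(1)]] True r0 that
        by (auto simp: continuous_on_eq_continuous_at)
      then have "isCont (\<lambda>\<theta>. V t0 (cis \<theta>)) \<theta>0" by (rule isCont_o2[OF cis_cont])
      then have "((\<lambda>\<theta>. V t0 (cis \<theta>)) \<longlongrightarrow> V t0 (cis \<theta>0)) (at \<theta>0)" by (simp only: isCont_def)
      then have "((\<lambda>\<theta>. V t0 (cis \<theta>)) \<longlongrightarrow> V t0 (cis \<theta>0)) (at \<theta>0 within S)"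
        by (rule tendsto_within_subset) simp
      then show ?thesis using that by simp
    qed
    have ev_left: "\<forall>\<^sub>F \<theta> in at_left pi. w t0 (cis \<theta>) = c' * V t0 (cis \<theta>)"
      unfolding eventually_at_left_field
    proof (intro exI[of _ "pi - \<psi>0"] conjI allI impI)
      fix \<theta> assume "pi - \<psi>0 < \<theta>" "\<theta> < pi"
      moreover have "x * cis (\<theta> - pi) = cis \<theta>" using True by (simp add: complex_eq_iff cos_diff sin_diff)
      ultimately show "w t0 (cis \<theta>) = c' * V t0 (cis \<theta>)" using c'[OF t0(1), of "\<theta> - pi"] by simp
    qed (use \<psi>0 in auto)
    have ev_right: "\<forall>\<^sub>F \<theta> in at_right (- pi). w t0 (cis \<theta>) = c * V t0 (cis \<theta>)"
      unfolding eventually_at_right_field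
    proof (intro exI[of _ "\<psi>0 - pi"] conjI allI impI)
      fix \<theta> assume "- pi < \<theta>" "\<theta> < \<psi>0 - pi"
      moreover have "x * cis (\<theta> + pi) = cis \<theta>" using True by (simp add: complex_eq_iff cos_add sin_add)
      ultimately show "w t0 (cis \<theta>) = c * V t0 (cis \<theta>)" using c[OF t0(1), of "\<theta> + pi"] by simp
    qed (use \<psi>0 in auto)
    have "((\<lambda>\<theta>. c' * V t0 (cis \<theta>)) \<longlongrightarrow> L) (at_left pi)"
      using L(1) ev_left by (rule Lim_transform_eventually)
    then have "L = c' * V t0 (-1)"
      by (rule tendsto_unique[rotated]) (auto intro!: tendsto_mult V_lim)
    moreover have "((\<lambda>\<theta>. c * V t0 (cis \<theta>)) \<longlongrightarrow> L) (at_right (- pi))"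
      using L(2) ev_right by (rule Lim_transform_eventually)
    then have "L = c * V t0 (-1)"
      by (rule tendsto_unique[rotated]) (auto intro!: tendsto_mult V_lim simp: complex_eq_iff)
    moreover have "V t0 (-1) \<noteq> 0" using weight_value_nonzero[OF wv[OF t0(1)]] True r0 by auto
    ultimately have cc: "c' = c" by simp
    show ?thesis
    proof (intro exI[of _ c] ballI allI impI)
      fix t \<psi> assume t: "t \<in> ball t0 \<eta>" "\<bar>\<psi>\<bar> < \<psi>0" "x * cis \<psi> \<noteq> -1"
      then have "\<psi> \<noteq> 0" using True by auto
      then show "w t (x * cis \<psi>) = c * V t (x * cis \<psi>)"
        using c[OF t(1)] c'[OF t(1)] t(2) cc by (cases "\<psi> > 0") (auto simp: abs_less_iff)
    qed
  qed
  then obtain c where c: "\<And>t \<psi>. t \<in> ball t0 \<eta> \<Longrightarrow> \<bar>\<psi>\<bar> < \<psi>0 \<Longrightarrow> x * cis \<psi> \<noteq> -1 \<Longrightarrow>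
      w t (x * cis \<psi>) = c * V t (x * cis \<psi>)" by blast
  have "isCont Arg 1" by (rule continuous_at_Arg) auto
  then have "(Arg \<longlongrightarrow> 0) (nhds 1)" using continuous_within[of 1 UNIV Arg] by (simp add: tendsto_nhds_iff)
  then have "\<forall>\<^sub>F u in nhds 1. dist (Arg u) 0 < \<psi>0" using tendstoD \<psi>0(1) by blast
  then obtain r where r: "r > 0" "\<And>u. dist u 1 < r \<Longrightarrow> \<bar>Arg u\<bar> < \<psi>0"
    unfolding eventually_nhds_metric by auto
  show thesis
  proof (rule that[OF r(1)])
    fix t \<theta> assume t: "t \<in> ball t0 \<eta>" and \<theta>: "\<theta> \<in> {- pi<..<pi}" and near: "cis \<theta> \<in> ball x r"
    define u where "u = cis \<theta> / x"
    have "u - 1 = (cis \<theta> - x) / x" using x0 by (simp add: u_def diff_divide_distrib)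
    then have "dist u 1 < r" using near x by (simp add: dist_norm norm_divide norm_minus_commute)
    then have "\<bar>Arg u\<bar> < \<psi>0" by (rule r(2))
    moreover have "norm u = 1" using x by (simp add: u_def norm_divide)
    then have "cis (Arg u) = u" using rcis_cmod_Arg[of u] by (simp add: rcis_def)
    then have xu: "x * cis (Arg u) = cis \<theta>" using x0 by (simp add: u_def)
    moreover have "cis \<theta> \<noteq> -1"
    proof
      assume "cis \<theta> = -1"
      then have "cos \<bar>\<theta>\<bar> = cos pi" by (simp add: complex_eq_iff)
      moreover have "\<bar>\<theta>\<bar> < pi" using \<theta> by (auto simp: abs_less_iff)
      ultimately show False using cos_inj_pi[of "\<bar>\<theta>\<bar>" pi] by auto
    qed
    ultimately show "w t (cis \<theta>) = c * V t (cis \<theta>)" using c[OF t, of "Arg u"] by simp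
  qed
qed

text \<open>
  The continuations of the second column exist separately for every \<open>t\<close>; they form a frame because
  \<open>V\<close> is continuous in \<open>t\<close> and \<open>c\<close> does not depend on \<open>t\<close>. The second conclusion serves to recognise \<open>Ymat\<close>
  itself as a frame.
\<close>
lemma local_frame_of_branch:
  assumes "r > 0" "\<eta> > 0" "ball t0 \<eta> \<subseteq> J"
    and V_cont: "continuous_on (ball t0 \<eta> \<times> ball x r) (\<lambda>(t, z). V t z)"
    and V_hol: "\<And>t. t \<in> ball t0 \<eta> \<Longrightarrow> V t holomorphic_on ball x r"
    and wv: "\<And>t z. t \<in> ball t0 \<eta> \<Longrightarrow> z \<in> ball x r \<Longrightarrow> weight_value m \<rho> (\<lambda>j. a j t) z (V t z)"
    and arc: "\<And>t \<theta>. t \<in> ball t0 \<eta> \<Longrightarrow> \<theta> \<in> {- pi<..<pi} \<Longrightarrow> cis \<theta> \<in> ball x r \<Longrightarrow>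
        w t (cis \<theta>) = c * V t (cis \<theta>)"
    and c: "c = 0 \<or> 0 \<notin> ball x r" and q: "\<And>t. t \<in> J \<Longrightarrow> degree (q t) = n"
  obtains H where "local_frame m \<rho> a (\<lambda>t. Y_column1 (p t) (q t)) (\<lambda>t. Y_column2_numerator (w t) n (p t) (q t))
      t0 (ball x (r / 3)) (\<lambda>t z. \<chi> i k. if k = 1 then Y_column1 (p t) (q t) i z else H t i z / V t z)"
    "\<And>t i z. t \<in> ball t0 \<eta> \<Longrightarrow> z \<in> ball x (r / 3) \<Longrightarrow> norm z \<noteq> 1 \<Longrightarrow> c = 0 \<Longrightarrow>
      H t i z = Y_column2_numerator (w t) n (p t) (q t) i z"
proof -
  have "\<exists>H :: 2 \<Rightarrow> complex \<Rightarrow> complex. (\<forall>i. H i holomorphic_on ball x (r / 3)) \<and>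
    (\<forall>i. \<forall>z\<in>ball x (r / 3). norm z > 1 \<longrightarrow> H i z = Y_column2_numerator (w t) n (p t) (q t) i z) \<and>
    (\<forall>i. \<forall>z\<in>ball x (r / 3). norm z < 1 \<longrightarrow>
       H i z = Y_column2_numerator (w t) n (p t) (q t) i z - 2 * c * V t z * Y_column1 (p t) (q t) i z)"
    if t: "t \<in> ball t0 \<eta>" for t
  proof -
    have tJ: "t \<in> J" using t assms(3) by blast
    show ?thesis
      by (rule Y_column2_continuation[OF w_integrable[OF tJ] V_hol[OF t] assms(1) arc[OF t] c q[OF tJ], where p = "p t"])
        blast+
  qed
  then obtain H :: "real \<Rightarrow> 2 \<Rightarrow> complex \<Rightarrow> complex" where
    H: "\<And>t i. t \<in> ball t0 \<eta> \<Longrightarrow> H t i holomorphic_on ball x (r / 3)"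
    "\<And>t i z. t \<in> ball t0 \<eta> \<Longrightarrow> z \<in> ball x (r / 3) \<Longrightarrow> norm z > 1 \<Longrightarrow>
       H t i z = Y_column2_numerator (w t) n (p t) (q t) i z"
    "\<And>t i z. t \<in> ball t0 \<eta> \<Longrightarrow> z \<in> ball x (r / 3) \<Longrightarrow> norm z < 1 \<Longrightarrow>
       H t i z = Y_column2_numerator (w t) n (p t) (q t) i z - 2 * c * V t z * Y_column1 (p t) (q t) i z"
    by metis
  have sub: "ball x (r / 3) \<subseteq> ball x r" using assms(1) by auto
  show thesis
  proof (rule that[of H])
    show "H t i z = Y_column2_numerator (w t) n (p t) (q t) i z"
      if "t \<in> ball t0 \<eta>" "z \<in> ball x (r / 3)" "norm z \<noteq> 1" "c = 0" for t i z
      using H(2,3)[OF that(1,2)] that(3,4) by (cases "norm z > 1") auto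
    show "local_frame m \<rho> a (\<lambda>t. Y_column1 (p t) (q t)) (\<lambda>t. Y_column2_numerator (w t) n (p t) (q t))
      t0 (ball x (r / 3)) (\<lambda>t z. \<chi> i k. if k = 1 then Y_column1 (p t) (q t) i z else H t i z / V t z)"
      unfolding local_frame_def
    proof (intro conjI exI[of _ \<eta>] exI[of _ V] exI[of _ H] exI[of _ c] ballI allI impI)
      show "continuous_on (ball t0 \<eta> \<times> ball x (r / 3)) (\<lambda>(t, z). V t z)"
        using V_cont by (rule continuous_on_subset) (use sub in blast)
      fix t assume t: "t \<in> ball t0 \<eta>"
      show "V t holomorphic_on ball x (r / 3)" using V_hol[OF t] sub by (rule holomorphic_on_subset)
      show "Y_column1 (p t) (q t) i holomorphic_on ball x (r / 3)" for i
        unfolding Y_column1_def by (cases "i = 1") (auto intro!: holomorphic_intros)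
      show "weight_value m \<rho> (\<lambda>j. a j t) z (V t z)" if "z \<in> ball x (r / 3)" for z
        using wv[OF t] sub that by blast
    qed (use H assms(2) in auto)
  qed
qed

text \<open>
  On the circle the constant \<open>c\<close> comes from \<open>weight_proportional_on_circle\<close>. Off the circle the ball is
  taken so small that it misses the circle, and \<open>c = 0\<close>.
\<close>
lemma local_frame_exists:
  assumes t0: "t0 \<in> J" and x: "\<And>j. j \<in> {1..m} \<Longrightarrow> x \<noteq> a j t0"
    and q: "\<And>t. t \<in> J \<Longrightarrow> degree (q t) = n"
  shows "\<exists>B F. x \<in> B \<and> local_frame m \<rho> a (\<lambda>t. Y_column1 (p t) (q t))
      (\<lambda>t. Y_column2_numerator (w t) n (p t) (q t)) t0 B F"
proof -
  obtain r0 \<eta> V where V: "r0 > 0" "\<eta> > 0" "ball t0 \<eta> \<subseteq> J"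
    "continuous_on (ball t0 \<eta> \<times> ball x r0) (\<lambda>(t, z). V t z)"
    "\<And>t. t \<in> ball t0 \<eta> \<Longrightarrow> V t holomorphic_on ball x r0"
    "\<And>t z. t \<in> ball t0 \<eta> \<Longrightarrow> z \<in> ball x r0 \<Longrightarrow> weight_value m \<rho> (\<lambda>j. a j t) z (V t z)"
    by (rule local_weight_branch_exists[OF open_J t0 a_cont x]) auto
  have "\<exists>r c. 0 < r \<and> (c = 0 \<or> 0 \<notin> ball x r) \<and> (\<forall>t\<in>ball t0 \<eta>. \<forall>\<theta>\<in>{- pi<..<pi}. cis \<theta> \<in> ball x r \<longrightarrow>
      w t (cis \<theta>) = c * V t (cis \<theta>))"
  proof (cases "norm x = 1")
    case True
    obtain r c where rc: "r > 0"
      "\<And>t \<theta>. t \<in> ball t0 \<eta> \<Longrightarrow> \<theta> \<in> {- pi<..<pi} \<Longrightarrow> cis \<theta> \<in> ball x r \<Longrightarrow> w t (cis \<theta>) = c * V t (cis \<theta>)"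
      by (rule weight_proportional_on_circle[OF True V]) auto
    \<comment> \<open>Radius at most 1 keeps the origin out of the ball, as required for \<open>c \<noteq> 0\<close>.\<close>
    show ?thesis
      using rc True by (intro exI[of _ "min r 1"] exI[of _ c]) auto
  next
    case False
    have "cis \<theta> \<notin> ball x \<bar>norm x - 1\<bar>" for \<theta>
      using norm_cis_diff_ge[of x \<theta>] by (simp add: dist_norm norm_minus_commute)
    then show ?thesis using False by (intro exI[of _ "\<bar>norm x - 1\<bar>"] exI[of _ 0]) auto
  qed
  then obtain r1 c where r1: "0 < r1" "c = 0 \<or> 0 \<notin> ball x r1"
    "\<And>t \<theta>. t \<in> ball t0 \<eta> \<Longrightarrow> \<theta> \<in> {- pi<..<pi} \<Longrightarrow> cis \<theta> \<in> ball x r1 \<Longrightarrow> w t (cis \<theta>) = c * V t (cis \<theta>)"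
    by blast
  define r where "r = min r0 r1"
  have r: "r > 0" "ball x r \<subseteq> ball x r0" "ball x r \<subseteq> ball x r1" using V(1) r1(1) by (auto simp: r_def)
  obtain H where "local_frame m \<rho> a (\<lambda>t. Y_column1 (p t) (q t)) (\<lambda>t. Y_column2_numerator (w t) n (p t) (q t))
      t0 (ball x (r / 3)) (\<lambda>t z. \<chi> i k. if k = 1 then Y_column1 (p t) (q t) i z else H t i z / V t z)"
  proof (rule local_frame_of_branch[OF r(1) V(2,3), where V = V and c = c and q = q and p = p])
    show "continuous_on (ball t0 \<eta> \<times> ball x r) (\<lambda>(t, z). V t z)"
      using V(4) by (rule continuous_on_subset) (use r in blast)
    show "V t holomorphic_on ball x r" if "t \<in> ball t0 \<eta>" for t
      using V(5)[OF that] r(2) by (rule holomorphic_on_subset)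
    show "weight_value m \<rho> (\<lambda>j. a j t) z (V t z)" if "t \<in> ball t0 \<eta>" "z \<in> ball x r" for t z
      using V(6) that r(2) by blast
    show "w t (cis \<theta>) = c * V t (cis \<theta>)"
      if "t \<in> ball t0 \<eta>" "\<theta> \<in> {- pi<..<pi}" "cis \<theta> \<in> ball x r" for t \<theta>
      using r1(3) that r(3) by blast
    show "c = 0 \<or> 0 \<notin> ball x r" using r1(2) r(3) by blast
  qed (use q that in auto)
  moreover have "x \<in> ball x (r / 3)" using r(1) by simp
  ultimately show ?thesis by blast
qed

text \<open>
  In the cut plane and off the unit circle \<open>Ymat\<close> itself is a frame, with \<open>V = w\<close>
  and \<open>c = 0\<close>. This lets continuation start and end with \<open>Ymat\<close>.
\<close>
lemma local_frame_Ymat: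
  assumes t0: "t0 \<in> J" and x: "x \<in> D t0" "norm x \<noteq> 1"
    and q: "\<And>t. t \<in> J \<Longrightarrow> degree (q t) = n"
  shows "\<exists>B. x \<in> B \<and> local_frame m \<rho> a (\<lambda>t. Y_column1 (p t) (q t))
      (\<lambda>t. Y_column2_numerator (w t) n (p t) (q t)) t0 B (\<lambda>t. Ymat (w t) n (p t) (q t))"
proof -
  have tx: "(t0, x) \<in> {(t, x). t \<in> J \<and> x \<in> D t}" using t0 x by simp
  obtain T S where TS: "open T" "open S" "(t0, x) \<in> T \<times> S" "T \<times> S \<subseteq> {(t, x). t \<in> J \<and> x \<in> D t}"
    by (rule open_prod_elim[OF cuts_cont tx]) (rule that)
  obtain \<eta> where \<eta>: "\<eta> > 0" "ball t0 \<eta> \<subseteq> T" using TS(1,3) by (auto simp: open_contains_ball)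
  obtain e where e: "e > 0" "ball x e \<subseteq> S" using TS(2,3) by (auto simp: open_contains_ball)
  define r where "r = min e \<bar>norm x - 1\<bar>"
  have r: "r > 0" "r \<le> e" "r \<le> \<bar>norm x - 1\<bar>" using e x by (auto simp: r_def)
  have dom: "t \<in> J" "z \<in> D t" if "t \<in> ball t0 \<eta>" "z \<in> ball x r" for t z
  proof -
    have "(t, z) \<in> T \<times> S" using that \<eta>(2) e(2) subset_ball[OF r(2), of x] by blast
    then have "(t, z) \<in> {(t, x). t \<in> J \<and> x \<in> D t}" using TS(4) by blast
    then show "t \<in> J" "z \<in> D t" by simp_all
  qed
  have ne1: "norm z \<noteq> 1" if "z \<in> ball x r" for z
  proof -
    have "\<bar>norm x - norm z\<bar> < r" using that norm_triangle_ineq3[of x z] by (simp add: dist_norm)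
    then show ?thesis using r(3) by auto
  qed
  have sub_J: "ball t0 \<eta> \<subseteq> J" using dom(1) centre_in_ball[of x r] r(1) by blast
  obtain H where H: "local_frame m \<rho> a (\<lambda>t. Y_column1 (p t) (q t)) (\<lambda>t. Y_column2_numerator (w t) n (p t) (q t))
      t0 (ball x (r / 3)) (\<lambda>t z. \<chi> i k. if k = 1 then Y_column1 (p t) (q t) i z else H t i z / w t z)"
    "\<And>t i z. t \<in> ball t0 \<eta> \<Longrightarrow> z \<in> ball x (r / 3) \<Longrightarrow> norm z \<noteq> 1 \<Longrightarrow> (0::complex) = 0 \<Longrightarrow>
      H t i z = Y_column2_numerator (w t) n (p t) (q t) i z"
  proof (rule local_frame_of_branch[OF r(1) \<eta>(1) sub_J, where V = w and c = 0 and q = q and p = p])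
    show "continuous_on (ball t0 \<eta> \<times> ball x r) (\<lambda>(t, z). w t z)"
      using w_cont by (rule continuous_on_subset) (use dom in auto)
    show "w t holomorphic_on ball x r" if "t \<in> ball t0 \<eta>" for t
    proof -
      have "t \<in> J" using sub_J that by blast
      then have "w t holomorphic_on D t" using w_branch unfolding weight_branch_def by blast
      then show ?thesis by (rule holomorphic_on_subset) (use dom(2)[OF that] in blast)
    qed
    show "weight_value m \<rho> (\<lambda>j. a j t) z (w t z)" if "t \<in> ball t0 \<eta>" "z \<in> ball x r" for t z
      using weight_value_D dom that by blast
    show "w t (cis \<theta>) = 0 * w t (cis \<theta>)" if "cis \<theta> \<in> ball x r" for t \<theta>
      using ne1[OF that] by simp
  qed (use q that in auto)
  have "(\<chi> i k. if k = 1 then Y_column1 (p t) (q t) i z else H t i z / w t z) = Ymat (w t) n (p t) (q t) z"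
    if "t \<in> ball t0 \<eta>" "z \<in> ball x (r / 3)" for t z
  proof -
    have "norm z \<noteq> 1" using ne1 that(2) r(1) by auto
    then have "(\<chi> i k. if k = 1 then Y_column1 (p t) (q t) i z else H t i z / w t z) $ i $ k
        = Ymat (w t) n (p t) (q t) z $ i $ k" for i k
      using H(2)[OF that] exhaust_2[of k] by (auto simp: Ymat_nth)
    then show ?thesis by (simp add: Finite_Cartesian_Product.vec_eq_iff)
  qed
  then have "local_frame m \<rho> a (\<lambda>t. Y_column1 (p t) (q t)) (\<lambda>t. Y_column2_numerator (w t) n (p t) (q t))
      t0 (ball x (r / 3)) (\<lambda>t. Ymat (w t) n (p t) (q t))"
    by (rule local_frame_cong[OF H(1) \<eta>(1)])
  moreover have "x \<in> ball x (r / 3)" using r(1) by simp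
  ultimately show ?thesis by blast
qed

end

section \<open>Biorthogonality and the determinant of $Y_n$\<close>

text \<open>
  Expand \<open>P\<close> in the basis \<open>b\<close>: only the component along \<open>b n\<close> contributes, and its coefficient is the
  quotient of the coefficients of degree \<open>n\<close>.
\<close>
lemma linear_functional_eq_top_coeff:
  fixes L :: "complex poly \<Rightarrow> complex"
  assumes add: "\<And>P Q. L (P + Q) = L P + L Q" and smult: "\<And>c P. L (Polynomial.smult c P) = c * L P"
    and b: "\<And>k. degree (b k) = k" "\<And>k. lead_coeff (b k) = \<kappa> k" "\<And>k. \<kappa> k \<noteq> 0"
    and L: "\<And>k. L (b k) = (if k = n then 1 else 0)"
    and "degree P \<le> n"
  shows "L P = coeff P n / \<kappa> n"
  using \<open>degree P \<le> n\<close>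
proof (induction "degree P" arbitrary: P rule: less_induct)
  case less
  define d where "d = degree P"
  define c where "c = coeff P d / \<kappa> d"
  define R where "R = P - Polynomial.smult c (b d)"
  have L0: "L 0 = 0" using smult[of 0 0] by simp
  have coeff_d: "coeff R d = 0"
    using b(1)[of d] b(2)[of d] b(3)[of d] by (simp add: R_def c_def)
  have deg_le: "degree R \<le> d" unfolding R_def d_def
    by (rule degree_diff_le) (auto intro: order_trans[OF Polynomial.degree_smult_le] simp: b(1))
  have "L R = 0"
  proof (cases "R = 0")
    case False
    then have "degree R \<noteq> d" using coeff_d leading_coeff_0_iff by blast
    then have "degree R < d" using deg_le by simp
    then show ?thesis
      using less.hyps[of R] less.prems coeff_eq_0[of R n] by (simp add: d_def)
  qed (simp add: L0)
  moreover have "P = R + Polynomial.smult c (b d)" by (simp add: R_def)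
  ultimately have "L P = c * (if d = n then 1 else 0)"
    using add[of R "Polynomial.smult c (b d)"] by (simp add: smult L)
  also have "\<dots> = coeff P n / \<kappa> n"
    using less.prems coeff_eq_0[of P n] by (auto simp: c_def d_def)
  finally show ?case .
qed

text \<open>
  The kernel \<open>(x + z) / (x - z)\<close> times the difference \<open>poly p x - poly p z\<close> is a polynomial in \<open>x\<close> with
  the degree and the leading coefficient of \<open>p\<close>. For constant \<open>p\<close> this polynomial is zero, hence \<open>n \<ge> 1\<close>.
\<close>
lemma divided_difference_coeff:
  fixes p :: "complex poly" and z :: complex
  assumes "degree p = n" "n \<ge> 1"
  defines "P \<equiv> [:z, 1:] * synthetic_div p z"
  shows "degree P \<le> n" "coeff P n = lead_coeff p"
    "\<And>x. x \<noteq> z \<Longrightarrow> poly P x = (x + z) / (x - z) * (poly p x - poly p z)"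
proof -
  let ?s = "synthetic_div p z"
  have p: "[:- z, 1:] * ?s + [:poly p z:] = p" by (rule synthetic_div_correct')
  have P: "P = p - [:poly p z:] + Polynomial.smult (2 * z) ?s"
  proof -
    have "Polynomial.smult z ?s = Polynomial.smult (- z) ?s + Polynomial.smult (2 * z) ?s"
    proof -
      have "- z + 2 * z = z" by simp
      then show ?thesis using Polynomial.smult_add_left[of "- z" "2 * z" ?s] by (simp only:)
    qed
    then have "P = [:- z, 1:] * ?s + Polynomial.smult (2 * z) ?s"
      unfolding P_def mult_pCons_left by (simp only: ac_simps)
    moreover have "[:- z, 1:] * ?s = p - [:poly p z:]" using p by (metis add_diff_cancel_right')
    ultimately show ?thesis by simp
  qed
  have deg_s: "degree ?s < n" using assms(1,2) by (simp add: degree_synthetic_div)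
  show "degree P \<le> n" unfolding P
    by (intro degree_add_le degree_diff_le order_trans[OF Polynomial.degree_smult_le])
      (use assms(1) deg_s in auto)
  show "coeff P n = lead_coeff p"
    using deg_s assms(1,2) by (simp add: P coeff_eq_0 coeff_pCons split: nat.split)
  fix x assume ne: "x \<noteq> z"
  have "poly p x - poly p z = (x - z) * poly ?s x"
    using arg_cong[OF p, of "\<lambda>r. poly r x"] by (simp add: algebra_simps)
  then have "(x + z) / (x - z) * (poly p x - poly p z) = (x + z) * poly ?s x"
    using ne by simp
  then show "poly P x = (x + z) / (x - z) * (poly p x - poly p z)"
    by (simp add: P_def algebra_simps)
qed

text \<open>
  Up to the factor \<open>z ^ n\<close> this is the Casoratian \<open>\<phi>* \<epsilon> + \<phi> \<epsilon>* = 2 z ^ n\<close>. Adding and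
  subtracting \<open>p n \<zeta> * q n (1 / \<zeta>)\<close>, the combined integrand splits into two divided differences,
  one tested against \<open>q n\<close> and one against \<open>p n\<close>. By \<open>linear_functional_eq_top_coeff\<close> each of the
  two integrals equals one.
\<close>
lemma biorthogonal_casoratian:
  fixes p q :: "nat \<Rightarrow> complex poly"
  assumes v: "integrable circ (\<lambda>\<theta>. v (cis \<theta>))"
    and p: "\<And>k. degree (p k) = k" "\<And>k. lead_coeff (p k) = \<kappa> k"
    and q: "\<And>k. degree (q k) = k" "\<And>k. lead_coeff (q k) = \<kappa> k"
    and \<kappa>: "\<And>k. \<kappa> k \<noteq> 0"
    and biorth: "\<And>k l. circle_mean (\<lambda>\<zeta>. v \<zeta> * poly (p k) \<zeta> * poly (q l) (inverse \<zeta>)) = (if k = l then 1 else 0)"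
    and n: "n \<ge> 1" and z: "norm z \<noteq> 1" "z \<noteq> 0"
  shows "poly (q n) (inverse z) * schwarz_integral (\<lambda>\<zeta>. v \<zeta> * poly (p n) \<zeta>) z
    - poly (p n) z * schwarz_integral (\<lambda>\<zeta>. v \<zeta> * poly (q n) (inverse \<zeta>)) z = 2"
proof -
  define br where "br P Q = circle_mean (\<lambda>\<zeta>. v \<zeta> * poly P \<zeta> * poly Q (inverse \<zeta>))" for P Q
  have br: "br P Q = integral\<^sup>L circ (\<lambda>\<theta>. v (cis \<theta>) * poly P (cis \<theta>) * poly Q (inverse (cis \<theta>))) / (2 * pi)" for P Q
    unfolding br_def by (rule circle_mean_eq_integral) (rule integrable_circ_weight(3)[OF v])
  note int = integrable_circ_weight(3)[OF v]
  have add1: "br (P + P') Q = br P Q + br P' Q" for P P' Q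
    using Bochner_Integration.integral_add[OF int[of P Q] int[of P' Q]]
    by (simp add: br algebra_simps add_divide_distrib)
  have add2: "br P (Q + Q') = br P Q + br P Q'" for P Q Q'
    using Bochner_Integration.integral_add[OF int[of P Q] int[of P Q']]
    by (simp add: br algebra_simps add_divide_distrib)
  have smult1: "br (Polynomial.smult c P) Q = c * br P Q" for c P Q
    using integral_mult_right_zero[of circ c "\<lambda>\<theta>. v (cis \<theta>) * poly P (cis \<theta>) * poly Q (inverse (cis \<theta>))"]
    by (simp add: br mult_ac)
  have smult2: "br P (Polynomial.smult c Q) = c * br P Q" for c P Q
    using integral_mult_right_zero[of circ c "\<lambda>\<theta>. v (cis \<theta>) * poly P (cis \<theta>) * poly Q (inverse (cis \<theta>))"]
    by (simp add: br mult_ac)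
  \<comment> \<open>The kernel changes sign under inversion of both arguments, so \<open>Q\<close> is evaluated at \<open>1 / \<zeta>\<close>.\<close>
  define P where "P = [:z, 1:] * synthetic_div (p n) z"
  define Q where "Q = [:inverse z, 1:] * synthetic_div (q n) (inverse z)"
  note P = divided_difference_coeff[OF p(1) n, where z = z, folded P_def]
  note Q = divided_difference_coeff[OF q(1) n, where z = "inverse z", folded Q_def]
  have "br P (q n) = coeff P n / \<kappa> n"
    by (rule linear_functional_eq_top_coeff[where b = p, OF add1 smult1 p \<kappa> _ P(1)])
      (simp add: br_def biorth)
  then have brP: "br P (q n) = 1" using P(2) p(2) \<kappa> by simp
  have "br (p n) Q = coeff Q n / \<kappa> n"
    by (rule linear_functional_eq_top_coeff[where b = q, OF add2 smult2 q \<kappa> _ Q(1)])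
      (auto simp: br_def biorth)
  then have brQ: "br (p n) Q = 1" using Q(2) q(2) \<kappa> by simp
  \<comment> \<open>It remains to identify the left-hand side with \<open>br P (q n) + br (p n) Q\<close>.\<close>
  define f where "f \<theta> = v (cis \<theta>) * poly (p n) (cis \<theta>)" for \<theta>
  define g where "g \<theta> = v (cis \<theta>) * poly (q n) (inverse (cis \<theta>))" for \<theta>
  define K where "K \<theta> = (cis \<theta> + z) / (cis \<theta> - z)" for \<theta>
  have Kint: "integrable circ (\<lambda>\<theta>. K \<theta> * u \<theta>)" if "integrable circ u" for u
    unfolding K_def using that z(1) by (rule integrable_schwarz_kernel)
  have f: "integrable circ f" and g: "integrable circ g"
    unfolding f_def g_def by (rule integrable_circ_weight(1,2)[OF v])+
  have S: "schwarz_integral (\<lambda>\<zeta>. v \<zeta> * poly (p n) \<zeta>) z = integral\<^sup>L circ (\<lambda>\<theta>. K \<theta> * f \<theta>) / (2 * pi)"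
    "schwarz_integral (\<lambda>\<zeta>. v \<zeta> * poly (q n) (inverse \<zeta>)) z = integral\<^sup>L circ (\<lambda>\<theta>. K \<theta> * g \<theta>) / (2 * pi)"
    unfolding schwarz_integral_def K_def f_def g_def
    by (rule circle_mean_eq_integral, use Kint[OF f] Kint[OF g] in \<open>simp add: K_def f_def g_def\<close>)+
  have pointwise: "poly (q n) (inverse z) * (K \<theta> * f \<theta>) - poly (p n) z * (K \<theta> * g \<theta>) =
      v (cis \<theta>) * poly P (cis \<theta>) * poly (q n) (inverse (cis \<theta>)) +
      v (cis \<theta>) * poly (p n) (cis \<theta>) * poly Q (inverse (cis \<theta>))" for \<theta>
  proof -
    have ne: "cis \<theta> \<noteq> z" using z by auto
    have 1: "poly P (cis \<theta>) = K \<theta> * (poly (p n) (cis \<theta>) - poly (p n) z)"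
      using P(3)[OF ne] by (simp add: K_def)
    have reflect: "(inverse c + inverse z) / (inverse c - inverse z) = - ((c + z) / (c - z))"
      if "c \<noteq> 0" "c \<noteq> z" for c
    proof -
      have "inverse c + inverse z = (c + z) / (c * z)" "inverse c - inverse z = - (c - z) / (c * z)"
        using that z(2) by (simp_all add: field_simps)
      then show ?thesis using that z(2) minus_divide_right[of "c + z" "c - z"] by simp
    qed
    have ne': "inverse (cis \<theta>) \<noteq> inverse z" using ne by (simp only: inverse_eq_iff_eq not_False_eq_True)
    have 2: "poly Q (inverse (cis \<theta>)) = - K \<theta> * (poly (q n) (inverse (cis \<theta>)) - poly (q n) (inverse z))"
      unfolding Q(3)[OF ne'] reflect[OF cis_neq_zero ne] K_def ..
    show ?thesis unfolding 1 2 f_def g_def by (simp add: algebra_simps)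
  qed
  have "integral\<^sup>L circ (\<lambda>\<theta>. poly (q n) (inverse z) * (K \<theta> * f \<theta>) - poly (p n) z * (K \<theta> * g \<theta>))
      = poly (q n) (inverse z) * integral\<^sup>L circ (\<lambda>\<theta>. K \<theta> * f \<theta>) - poly (p n) z * integral\<^sup>L circ (\<lambda>\<theta>. K \<theta> * g \<theta>)"
    using Kint[OF f] Kint[OF g]
    by (simp only: Bochner_Integration.integral_diff integrable_mult_right integral_mult_right_zero)
  moreover have "integral\<^sup>L circ (\<lambda>\<theta>. poly (q n) (inverse z) * (K \<theta> * f \<theta>) - poly (p n) z * (K \<theta> * g \<theta>)) / (2 * pi)
      = br P (q n) + br (p n) Q"
    unfolding pointwise br Bochner_Integration.integral_add[OF int int] by (rule add_divide_distrib)
  ultimately show ?thesis unfolding S brP brQ by (simp add: diff_divide_distrib)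
qed

section \<open>The monodromy matrices\<close>

lemma matrix_cancel_left_2:
  fixes A M M' :: "complex^2^2"
  assumes "A ** M = A ** M'" and det: "A $ 1 $ 1 * A $ 2 $ 2 - A $ 2 $ 1 * A $ 1 $ 2 \<noteq> 0"
  shows "M = M'"
proof -
  have eq: "A $ i $ 1 * (M $ 1 $ k - M' $ 1 $ k) + A $ i $ 2 * (M $ 2 $ k - M' $ 2 $ k) = 0" for i k
  proof -
    have "(A ** M) $ i $ k = (A ** M') $ i $ k" using assms(1) by simp
    then show ?thesis by (simp add: matrix_matrix_mult_def sum_2 algebra_simps)
  qed
  have cramer: "(a * e - c * b) * x = 0" "(a * e - c * b) * y = 0"
    if "a * x + b * y = 0" "c * x + e * y = 0" for a b c e x y :: complex
  proof -
    have "(a * e - c * b) * x = e * (a * x + b * y) - b * (c * x + e * y)"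
      "(a * e - c * b) * y = a * (c * x + e * y) - c * (a * x + b * y)"
      by (simp_all add: algebra_simps)
    then show "(a * e - c * b) * x = 0" "(a * e - c * b) * y = 0" using that by simp_all
  qed
  have "M $ 1 $ k - M' $ 1 $ k = 0" "M $ 2 $ k - M' $ 2 $ k = 0" for k
    using cramer[OF eq[of 1 k] eq[of 2 k]] det by (simp_all only: mult_eq_0_iff simp_thms)
  then show ?thesis by (simp add: Finite_Cartesian_Product.vec_eq_iff forall_2)
qed

lemma monodromy_unique:
  assumes "is_monodromy \<gamma> Y M" "is_monodromy \<gamma> Y M'" "continuous_on UNIV \<gamma>"
    and "Y (\<gamma> 1) $ 1 $ 1 * Y (\<gamma> 1) $ 2 $ 2 - Y (\<gamma> 1) $ 2 $ 1 * Y (\<gamma> 1) $ 1 $ 2 \<noteq> 0"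
  shows "M = M'"
proof -
  have "\<forall>\<^sub>F z in nhds (\<gamma> 1). Y z ** M = Y z ** M'"
    using assms(1,2) unfolding is_monodromy_def continues_along_iff_between
    by (rule continues_between_unique) (use assms(3) in \<open>auto intro: continuous_on_subset\<close>)
  then have "Y (\<gamma> 1) ** M = Y (\<gamma> 1) ** M'" by (rule eventually_nhds_x_imp_x)
  then show ?thesis using assms(4) by (rule matrix_cancel_left_2)
qed

context deformed_weight
begin

lemma monodromy_locally_constant:
  assumes t0: "t0 \<in> J" and q: "\<And>t. t \<in> J \<Longrightarrow> degree (q t) = n"
    and \<gamma>: "continuous_on UNIV \<gamma>" "\<gamma> 1 = \<gamma> 0" "\<And>s j. j \<in> {1..m} \<Longrightarrow> \<gamma> s \<noteq> a j t0"
      "\<gamma> 0 \<in> D t0" "norm (\<gamma> 0) \<noteq> 1"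
    and d: "(d \<longlongrightarrow> 0) (nhds t0)"
  shows "\<exists>M. \<forall>\<^sub>F t in nhds t0. is_monodromy (\<lambda>s. \<gamma> s + d t) (Ymat (w t) n (p t) (q t)) M"
proof -
  define frames where "frames = {(B, F). local_frame m \<rho> a (\<lambda>t. Y_column1 (p t) (q t))
      (\<lambda>t. Y_column2_numerator (w t) n (p t) (q t)) t0 B F}"
  have frames_iff: "(B, F) \<in> frames \<longleftrightarrow> local_frame m \<rho> a (\<lambda>t. Y_column1 (p t) (q t))
      (\<lambda>t. Y_column2_numerator (w t) n (p t) (q t)) t0 B F" for B F
    by (simp add: frames_def)
  have "\<exists>B. \<gamma> 0 \<in> B \<and> (B, \<lambda>t. Ymat (w t) n (p t) (q t)) \<in> frames"
    unfolding frames_iff by (rule local_frame_Ymat[OF t0 \<gamma>(4,5) q])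
  then obtain B where B: "\<gamma> 0 \<in> B" "(B, \<lambda>t. Ymat (w t) n (p t) (q t)) \<in> frames"
    by (elim exE conjE) (rule that)
  have "\<exists>N. \<forall>\<^sub>F t in nhds t0. continues_between (\<lambda>s. \<gamma> s + d t) 0 1 (Ymat (w t) n (p t) (q t))
      (\<lambda>z. Ymat (w t) n (p t) (q t) z ** N)"
  proof (rule continuation_through_frames[OF \<gamma>(1) d, where frames = frames])
    fix s
    have "\<exists>B F. \<gamma> s \<in> B \<and> (B, F) \<in> frames"
      unfolding frames_iff by (rule local_frame_exists[OF t0 \<gamma>(3) q])
    then show "\<exists>B F. (B, F) \<in> frames \<and> \<gamma> s \<in> B" by (simp only: conj_commute)
  next
    fix B F assume BF: "(B, F) \<in> frames"
    then show "open B" unfolding frames_iff local_frame_def by (elim conjE)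
    show "\<forall>\<^sub>F t in nhds t0. \<forall>i k. (\<lambda>z. F t z $ i $ k) holomorphic_on B"
      using BF unfolding frames_iff by (rule local_frame_holomorphic)
    fix B' F' assume "(B', F') \<in> frames"
    with BF show "\<exists>N. \<forall>\<^sub>F t in nhds t0. \<forall>z\<in>B \<inter> B'. F t z = F' t z ** N"
      unfolding frames_iff by (rule local_frame_transition)
  next
    show "(B, \<lambda>t. Ymat (w t) n (p t) (q t)) \<in> frames" "(B, \<lambda>t. Ymat (w t) n (p t) (q t)) \<in> frames"
      by (rule B(2))+
    show "\<gamma> 0 \<in> B" "\<gamma> 1 \<in> B" using B(1) \<gamma>(2) by simp_all
  qed simp
  then show ?thesis unfolding is_monodromy_def continues_along_iff_between .
qed

text \<open>
  The loop \<open>\<gamma>\<close> for \<open>t0\<close> is translated by \<open>d t\<close>. The base point stays in the cut plane and off the unit circle for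
  \<open>t\<close> near \<open>t0\<close>, where invertibility of \<open>Ymat\<close> makes the constant matrix of
  \<open>monodromy_locally_constant\<close> the only one.
\<close>
lemma monodromy_stationary:
  assumes t0: "t0 \<in> J" and q: "\<And>t. t \<in> J \<Longrightarrow> degree (q t) = n"
    and \<gamma>: "continuous_on UNIV \<gamma>" "\<gamma> 1 = \<gamma> 0" "\<And>s j. j \<in> {1..m} \<Longrightarrow> \<gamma> s \<noteq> a j t0"
      "\<gamma> 0 \<in> D t0" "norm (\<gamma> 0) \<noteq> 1"
    and d: "(d \<longlongrightarrow> 0) (nhds t0)"
    and det: "\<And>t x. t \<in> J \<Longrightarrow> x \<in> D t \<Longrightarrow> norm x \<noteq> 1 \<Longrightarrow>
      Ymat (w t) n (p t) (q t) x $ 1 $ 1 * Ymat (w t) n (p t) (q t) x $ 2 $ 2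
      - Ymat (w t) n (p t) (q t) x $ 2 $ 1 * Ymat (w t) n (p t) (q t) x $ 1 $ 2 \<noteq> 0"
  shows "\<forall>\<^sub>F t in nhds t0. \<exists>!M. is_monodromy (\<lambda>s. \<gamma> s + d t) (Ymat (w t) n (p t) (q t)) M"
    and "((\<lambda>t. monodromy_matrix (\<lambda>s. \<gamma> s + d t) (Ymat (w t) n (p t) (q t))) has_vector_derivative 0) (at t0)"
proof -
  let ?Y = "\<lambda>t. Ymat (w t) n (p t) (q t)"
  have "\<exists>M. \<forall>\<^sub>F t in nhds t0. is_monodromy (\<lambda>s. \<gamma> s + d t) (?Y t) M"
    by (rule monodromy_locally_constant[OF t0 q \<gamma> d])
  then obtain M where M: "\<forall>\<^sub>F t in nhds t0. is_monodromy (\<lambda>s. \<gamma> s + d t) (?Y t) M"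
    by (elim exE) (rule that)
  have lim: "((\<lambda>t. (t, \<gamma> 1 + d t)) \<longlongrightarrow> (t0, \<gamma> 1 + 0)) (nhds t0)"
    by (intro tendsto_intros d) (simp add: filterlim_ident)
  have ev1: "\<forall>\<^sub>F t in nhds t0. (t, \<gamma> 1 + d t) \<in> {(t, x). t \<in> J \<and> x \<in> D t}"
    by (rule topological_tendstoD[OF lim cuts_cont]) (use t0 \<gamma> in simp)
  have "((\<lambda>t. norm (\<gamma> 1 + d t)) \<longlongrightarrow> norm (\<gamma> 1 + 0)) (nhds t0)" by (intro tendsto_intros d)
  then have ev2: "\<forall>\<^sub>F t in nhds t0. norm (\<gamma> 1 + d t) \<noteq> 1"
    by (rule tendsto_imp_eventually_ne) (use \<gamma> in simp)
  have ev: "\<forall>\<^sub>F t in nhds t0. \<forall>M'. is_monodromy (\<lambda>s. \<gamma> s + d t) (?Y t) M' \<longleftrightarrow> M' = M"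
    using M ev1 ev2
  proof eventually_elim
    case (elim t)
    have "M' = M" if "is_monodromy (\<lambda>s. \<gamma> s + d t) (?Y t) M'" for M'
      by (rule monodromy_unique[OF that elim(1)])
        (use det[of t "\<gamma> 1 + d t"] elim(2,3) \<gamma>(1) in \<open>auto intro!: continuous_intros\<close>)
    then show ?case using elim(1) by blast
  qed
  then show "\<forall>\<^sub>F t in nhds t0. \<exists>!M. is_monodromy (\<lambda>s. \<gamma> s + d t) (?Y t) M"
    by eventually_elim simp
  have "\<forall>\<^sub>F t in nhds t0. monodromy_matrix (\<lambda>s. \<gamma> s + d t) (?Y t) = M"
    using ev by eventually_elim (simp add: monodromy_matrix_def)
  then obtain S where S: "open S" "t0 \<in> S" "\<And>t. t \<in> S \<Longrightarrow> monodromy_matrix (\<lambda>s. \<gamma> s + d t) (?Y t) = M"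
    unfolding eventually_nhds by blast
  show "((\<lambda>t. monodromy_matrix (\<lambda>s. \<gamma> s + d t) (?Y t)) has_vector_derivative 0) (at t0)"
    by (rule has_vector_derivative_transform_within_open[of "\<lambda>_. M" 0 t0 S]) (use S in auto)
qed

end

lemma continuous_on_loop_at: "continuous_on S (loop_at x \<delta>)"
  unfolding loop_at_def[abs_def] by (intro continuous_intros continuous_on_cis)

lemma continuous_on_loop_at_infinity: "\<delta> \<noteq> 0 \<Longrightarrow> continuous_on S (loop_at_infinity \<delta>)"
  unfolding loop_at_infinity_def[abs_def] by (intro continuous_intros continuous_on_cis) auto

theorem proposition3p4:
  fixes I :: "real set"
    and m n :: nat
    and z :: "nat \<Rightarrow> real \<Rightarrow> complex"
    and \<rho> :: "nat \<Rightarrow> complex"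
    and D :: "real \<Rightarrow> complex set"
    and w :: "real \<Rightarrow> complex \<Rightarrow> complex"
    and \<kappa> :: "real \<Rightarrow> nat \<Rightarrow> complex"
    and \<phi> \<phi>bar :: "real \<Rightarrow> nat \<Rightarrow> complex poly"
  defines "Y \<equiv> \<lambda>t. Ymat (w t) n (\<phi> t n) (\<phi>bar t n)"
  assumes I: "open I" "is_interval I"
    and m: "m \<ge> 2"
    and z_diff: "\<And>t j. t \<in> I \<Longrightarrow> j \<in> {1..m} \<Longrightarrow> z j differentiable (at t)"
    and z_distinct: "\<And>t. t \<in> I \<Longrightarrow> inj_on (\<lambda>j. z j t) {1..m}"
    and z_origin: "\<And>t. t \<in> I \<Longrightarrow> z 1 t = 0"
    and \<rho>: "\<And>j. j \<in> {1..m} \<Longrightarrow> \<rho> j \<notin> \<nat>"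
    and cut_plane: "\<And>t. t \<in> I \<Longrightarrow> open (D t) \<and> connected (D t) \<and> closure (D t) = UNIV"
    and w_branch: "\<And>t. t \<in> I \<Longrightarrow> weight_branch m \<rho> (\<lambda>j. z j t) (D t) (w t)"
    and w_circle: "\<And>t. t \<in> I \<Longrightarrow> sphere 0 1 - {-1} - (\<lambda>j. z j t) ` {1..m} \<subseteq> D t"
    and cuts_cont: "open {(t, x). t \<in> I \<and> x \<in> D t}"
    and w_cont: "continuous_on {(t, x). t \<in> I \<and> x \<in> D t} (\<lambda>(t, x). w t x)"
    and w_match: "\<And>t. t \<in> I \<Longrightarrow>
          \<exists>L. ((\<lambda>\<theta>. w t (cis \<theta>)) \<longlongrightarrow> L) (at_left pi) \<and> ((\<lambda>\<theta>. w t (cis \<theta>)) \<longlongrightarrow> L) (at_right (- pi))"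
    and w_L1: "\<And>t k. t \<in> I \<Longrightarrow> circle_L1 (\<lambda>\<zeta>. \<zeta> powi k * w t \<zeta>)"
    and w'_L1: "\<And>t k. t \<in> I \<Longrightarrow> circle_L1 (\<lambda>\<zeta>. \<zeta> powi k * deriv (w t) \<zeta>)"
    and toeplitz: "\<And>t k. t \<in> I \<Longrightarrow> k \<ge> 1 \<Longrightarrow> toeplitz_det (w t) k \<noteq> 0"
    and \<kappa>_nz: "\<And>t k. t \<in> I \<Longrightarrow> \<kappa> t k \<noteq> 0"
    and \<kappa>_diff: "\<And>t k. t \<in> I \<Longrightarrow> (\<lambda>s. \<kappa> s k) differentiable (at t)"
    and \<phi>_lead: "\<And>t k. t \<in> I \<Longrightarrow> degree (\<phi> t k) = k \<and> lead_coeff (\<phi> t k) = \<kappa> t k"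
    and \<phi>bar_lead: "\<And>t k. t \<in> I \<Longrightarrow> degree (\<phi>bar t k) = k \<and> lead_coeff (\<phi>bar t k) = \<kappa> t k"
    and biorth: "\<And>t k l. t \<in> I \<Longrightarrow>
          circle_mean (\<lambda>\<zeta>. w t \<zeta> * poly (\<phi> t k) \<zeta> * poly (\<phi>bar t l) (inverse \<zeta>)) = (if k = l then 1 else 0)"
    and \<phi>_0: "\<And>t k. t \<in> I \<Longrightarrow> poly (\<phi> t k) 0 \<noteq> 0"
    and \<phi>bar_0: "\<And>t k. t \<in> I \<Longrightarrow> poly (\<phi>bar t k) 0 \<noteq> 0"
    and n: "n \<ge> 1"
  shows
    "(\<forall>t\<^sub>0\<in>I. \<forall>j\<in>{1..m}. \<forall>\<delta>.
        \<delta> \<noteq> 0 \<and> (\<forall>k\<in>{1..m} - {j}. norm \<delta> < dist (z k t\<^sub>0) (z j t\<^sub>0)) \<and>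
        z j t\<^sub>0 + \<delta> \<in> D t\<^sub>0 \<and> norm (z j t\<^sub>0 + \<delta>) \<noteq> 1 \<longrightarrow>
        (\<forall>\<^sub>F t in nhds t\<^sub>0. \<exists>!M. is_monodromy (loop_at (z j t) \<delta>) (Y t) M) \<and>
        ((\<lambda>t. monodromy_matrix (loop_at (z j t) \<delta>) (Y t)) has_vector_derivative 0) (at t\<^sub>0)) \<and>
     (\<forall>t\<^sub>0\<in>I. \<forall>\<delta>.
        \<delta> \<noteq> 0 \<and> (\<forall>k\<in>{1..m}. norm (z k t\<^sub>0) < norm (1 / \<delta>)) \<and>
        1 / \<delta> \<in> D t\<^sub>0 \<and> norm (1 / \<delta>) \<noteq> 1 \<longrightarrow>
        (\<forall>\<^sub>F t in nhds t\<^sub>0. \<exists>!M. is_monodromy (loop_at_infinity \<delta>) (Y t) M) \<and>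
        ((\<lambda>t. monodromy_matrix (loop_at_infinity \<delta>) (Y t)) has_vector_derivative 0) (at t\<^sub>0))"
proof -
  have z_cont: "continuous_on I (z j)" if "j \<in> {1..m}" for j
    using z_diff[OF _ that] differentiable_imp_continuous_within
    by (auto simp: continuous_on_eq_continuous_at[OF I(1)])
  have w_int: "integrable circ (\<lambda>\<theta>. w t (cis \<theta>))" if "t \<in> I" for t
    using circle_L1_integrable_circ[OF w_L1[OF that, of 0]] by simp
  interpret deformed_weight I m \<rho> z D w
    by (unfold_locales; fact)
  have deg: "degree (\<phi>bar t n) = n" if "t \<in> I" for t
    using \<phi>bar_lead[OF that] by blast
  have det: "Ymat (w t) n (\<phi> t n) (\<phi>bar t n) x $ 1 $ 1 * Ymat (w t) n (\<phi> t n) (\<phi>bar t n) x $ 2 $ 2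
      - Ymat (w t) n (\<phi> t n) (\<phi>bar t n) x $ 2 $ 1 * Ymat (w t) n (\<phi> t n) (\<phi>bar t n) x $ 1 $ 2 \<noteq> 0"
    if t: "t \<in> I" and x: "x \<in> D t" "norm x \<noteq> 1" for t x
  proof -
    have wv: "weight_value m \<rho> (\<lambda>j. z j t) x (w t x)" using weight_value_D[OF t x(1)] .
    have x0: "x \<noteq> 0" using weight_value_not_singular[OF wv, of 1] z_origin[OF t] m by simp
    have w0: "w t x \<noteq> 0" using weight_value_nonzero[OF wv] .
    define S1 where "S1 = schwarz_integral (\<lambda>\<zeta>. w t \<zeta> * poly (\<phi> t n) \<zeta>) x"
    define S2 where "S2 = schwarz_integral (\<lambda>\<zeta>. w t \<zeta> * poly (\<phi>bar t n) (inverse \<zeta>)) x"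
    have "poly (\<phi>bar t n) (inverse x) * S1 - poly (\<phi> t n) x * S2 = 2"
      unfolding S1_def S2_def
      by (rule biorthogonal_casoratian[where \<kappa> = "\<kappa> t", OF w_int[OF t]])
        (use \<phi>_lead[OF t] \<phi>bar_lead[OF t] \<kappa>_nz[OF t] biorth[OF t] n x(2) x0 in blast)+
    then have "poly (\<phi> t n) x * S2 - poly (\<phi>bar t n) (inverse x) * S1 = - 2"
      by (metis minus_diff_eq)
    moreover have "poly (\<phi> t n) x * (x ^ n * S2 / w t x) - x ^ n * poly (\<phi>bar t n) (inverse x) * (S1 / w t x)
        = x ^ n / w t x * (poly (\<phi> t n) x * S2 - poly (\<phi>bar t n) (inverse x) * S1)"
      by (simp add: algebra_simps)
    ultimately have "poly (\<phi> t n) x * (x ^ n * S2 / w t x) - x ^ n * poly (\<phi>bar t n) (inverse x) * (S1 / w t x) \<noteq> 0"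
      using x0 w0 by simp
    then show ?thesis
      using x0 deg[OF t]
      by (simp add: Ymat_nth Y_column1_def Y_column2_numerator_def assoc_eps_eq assoc_eps_star_eq
          poly_reflect_poly_nz S1_def S2_def)
  qed
  have stationary: "(\<forall>\<^sub>F t in nhds t0. \<exists>!M. is_monodromy (\<lambda>s. \<gamma> s + d t) (Y t) M) \<and>
      ((\<lambda>t. monodromy_matrix (\<lambda>s. \<gamma> s + d t) (Y t)) has_vector_derivative 0) (at t0)"
    if "t0 \<in> I" "continuous_on UNIV \<gamma>" "\<gamma> 1 = \<gamma> 0" "\<And>s j. j \<in> {1..m} \<Longrightarrow> \<gamma> s \<noteq> z j t0"
      "\<gamma> 0 \<in> D t0" "norm (\<gamma> 0) \<noteq> 1" "(d \<longlongrightarrow> 0) (nhds t0)" for t0 \<gamma> d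
    unfolding Y_def using monodromy_stationary[OF that(1) deg that(2-7) det] by blast
  show ?thesis
  proof (rule conjI; intro ballI allI impI; elim conjE)
    fix t0 j \<delta>
    assume t0: "t0 \<in> I" and j: "j \<in> {1..m}" and \<delta>: "\<delta> \<noteq> 0"
      and sep: "\<forall>k\<in>{1..m} - {j}. norm \<delta> < dist (z k t0) (z j t0)"
      and base: "z j t0 + \<delta> \<in> D t0" "norm (z j t0 + \<delta>) \<noteq> 1"
    have shift: "(\<lambda>s. loop_at (z j t0) \<delta> s + (z j t - z j t0)) = loop_at (z j t) \<delta>" for t
      by (simp add: loop_at_def fun_eq_iff)
    have "(\<forall>\<^sub>F t in nhds t0. \<exists>!M.
          is_monodromy (\<lambda>s. loop_at (z j t0) \<delta> s + (z j t - z j t0)) (Y t) M) \<and>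
        ((\<lambda>t. monodromy_matrix (\<lambda>s. loop_at (z j t0) \<delta> s + (z j t - z j t0)) (Y t))
          has_vector_derivative 0) (at t0)"
    proof (rule stationary[OF t0 continuous_on_loop_at])
      show "loop_at (z j t0) \<delta> s \<noteq> z k t0" if k: "k \<in> {1..m}" for s k
      proof
        assume "loop_at (z j t0) \<delta> s = z k t0"
        then have "z k t0 - z j t0 = \<delta> * cis (2 * pi * s)" by (simp add: loop_at_def algebra_simps)
        then have "dist (z k t0) (z j t0) = norm \<delta>" by (simp add: dist_norm norm_mult)
        moreover have "norm \<delta> < dist (z k t0) (z j t0)" if "k \<noteq> j"
          using bspec[OF sep, of k] k that by blast
        ultimately show False using \<delta> by (cases "k = j") auto
      qed
      have "isCont (z j) t0" using z_cont[OF j] t0 I(1) by (simp add: continuous_on_eq_continuous_at)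
      then have "(z j \<longlongrightarrow> z j t0) (nhds t0)" by (simp only: isCont_def tendsto_nhds_iff)
      then show "((\<lambda>t. z j t - z j t0) \<longlongrightarrow> 0) (nhds t0)"
        using tendsto_diff[of "z j" "z j t0" "nhds t0" "\<lambda>_. z j t0" "z j t0"] by simp
    qed (use base in \<open>simp_all add: loop_at_def\<close>)
    then show "(\<forall>\<^sub>F t in nhds t0. \<exists>!M. is_monodromy (loop_at (z j t) \<delta>) (Y t) M) \<and>
        ((\<lambda>t. monodromy_matrix (loop_at (z j t) \<delta>) (Y t)) has_vector_derivative 0) (at t0)"
      by (simp only: shift)
  next
    fix t0 \<delta>
    assume t0: "t0 \<in> I" and \<delta>: "\<delta> \<noteq> 0" and far: "\<forall>k\<in>{1..m}. norm (z k t0) < norm (1 / \<delta>)"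
      and base: "1 / \<delta> \<in> D t0" "norm (1 / \<delta>) \<noteq> 1"
    have "(\<forall>\<^sub>F t in nhds t0. \<exists>!M. is_monodromy (\<lambda>s. loop_at_infinity \<delta> s + 0) (Y t) M) \<and>
        ((\<lambda>t. monodromy_matrix (\<lambda>s. loop_at_infinity \<delta> s + 0) (Y t)) has_vector_derivative 0) (at t0)"
    proof (rule stationary[OF t0 continuous_on_loop_at_infinity[OF \<delta>]])
      show "loop_at_infinity \<delta> s \<noteq> z k t0" if k: "k \<in> {1..m}" for s k
      proof
        assume "loop_at_infinity \<delta> s = z k t0"
        then have "norm (z k t0) = norm (1 / \<delta>)"
          unfolding loop_at_infinity_def by (metis norm_cis mult_1_right norm_divide norm_mult)
        then show False using bspec[OF far k] by simp
      qed
    qed (use base in \<open>simp_all add: loop_at_infinity_def\<close>)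
    then show "(\<forall>\<^sub>F t in nhds t0. \<exists>!M. is_monodromy (loop_at_infinity \<delta>) (Y t) M) \<and>
        ((\<lambda>t. monodromy_matrix (loop_at_infinity \<delta>) (Y t)) has_vector_derivative 0) (at t0)"
      by simp
  qed
qed

end
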